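(* Let $\Delta\subset\mathbb{R}^n$ be a simplicial complex of dimension $1$ with $e$ edges and $m$ vertices $v_1,\dots,v_m$, of which $m_0$ are isolated. Let $E$ be the set of pairs $(i,j)$ with $1\le i<j\le m$ such that $v_i$ and $v_j$ are the endpoints of an edge of $\Delta$. Let $T_1,\dots,T_m\in\mathcal{C}^0(\Delta)$ be the tent functions on $\Delta$. A function $F\in\mathcal{C}^0(\Delta)$ is non-negative on $\Delta$ if and only if there exist sums of squares $S$ and $S_{ij}$ ($(i,j)\in E$) of elements of $\mathcal{C}^0(\Delta)$ such that \[ F=S+\sum_{(i,j)\in E}S_{ij}T_iT_j . \] More precisely, if $F$ is non-negative on $\Delta$, there exist such $S$ and $S_{ij}$ of degree at most $\deg(F)+6(e-1)+1$, where $S$ is a sum of at most $2e+m_0$ squares of elements of $\mathcal{C}^0(\Delta)$ and each $S_{ij}$ is a sum of two squares of elements of $\mathcal{C}^0(\Delta)$.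
   Context: For affinely independent $v_0,\dots,v_d\in\mathbb{R}^n$, $\sigma(v_0,\dots,v_d)$ denotes the $d$-simplex that is their convex hull; its faces are the simplices spanned by subsets of $\{v_0,\dots,v_d\}$ (including the empty one). A simplicial complex in $\mathbb{R}^n$ is a finite union $\Delta=\sigma_1\cup\dots\cup\sigma_k$ of simplices such that $\sigma_i\cap\sigma_j$ is a face of both $\sigma_i$ and $\sigma_j$ for all $i,j$; one assumes $\sigma_i\nsubseteq\sigma_j$ for $i\ne j$. The vertices of $\Delta$ are the vertices of the $\sigma_i$. When $\Delta$ has dimension $1$, its edges are the $1$-dimensional $\sigma_i$ (so $e\ge 1$), and a vertex is isolated if it is not an endpoint of any edge. $\mathcal{C}^0(\Delta)$ is the $\mathbb{R}$-algebra (under pointwise operations) of all continuous functions $F\colon\Delta\to\mathbb{R}$ for which there are polynomials $g_1,\dots,g_k\in\mathbb{R}[t_1,\dots,t_n]$ with $F|_{\sigma_i}=g_i|_{\sigma_i}$ for all $i$. The tent function $T_i$ is the unique element of $\mathcal{C}^0(\Delta)$ that is piecewise linear (i.e. affine-linear on each simplex $\sigma_j$) with $T_i(v_i)=1$ and $T_i(v_j)=0$ for $j\neq i$. The degree of $F\in\mathcal{C}^0(\Delta)$ is $\deg(F)=\min\max_i\deg(f_i)$, where the minimum is over all $k$-tuples $(f_1,\dots,f_k)$ of polynomials in $\mathbb{R}[t_1,\dots,t_n]$ with $F|_{\sigma_i}=f_i|_{\sigma_i}$ for all $i$. *)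

theory Defs
  imports "HOL-Analysis.Analysis" "HOL-Library.Poly_Mapping"
begin

section \<open>Polynomials in the coordinates of \<open>real ^ 'n\<close>\<close>

text \<open>A monomial is an exponent vector \<open>'n \<Rightarrow>\<^sub>0 nat\<close>, so that \<open>'n mpoly\<close>, with the ring structure
  from \<^theory>\<open>HOL-Library.Poly_Mapping\<close>, is the polynomial ring over the reals in one
  indeterminate for each coordinate.\<close>

type_synonym 'n mpoly = "('n \<Rightarrow>\<^sub>0 nat) \<Rightarrow>\<^sub>0 real"

definition peval :: "'n::finite mpoly \<Rightarrow> real ^ 'n \<Rightarrow> real" where
  "peval p x = (\<Sum>a\<in>Poly_Mapping.keys p. Poly_Mapping.lookup p a * (\<Prod>i\<in>UNIV. (x $ i) ^ Poly_Mapping.lookup a i))"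

text \<open>Total degree, with the convention that the zero polynomial has degree 0.\<close>

definition total_degree :: "'n::finite mpoly \<Rightarrow> nat" where
  "total_degree p = Max (insert 0 ((\<lambda>a. \<Sum>i\<in>UNIV. Poly_Mapping.lookup a i) ` Poly_Mapping.keys p))"


section \<open>Simplicial complexes\<close>

text \<open>A complex is given by the set \<open>K\<close> of its simplices \<open>\<sigma>\<^sub>1, \<dots>, \<sigma>\<^sub>k\<close>, none of which contains
  another. Unlike for the library's \<^const>\<open>simplicial_complex\<close>, the set \<open>K\<close> is therefore
  not closed under passing to faces. The underlying subset of \<open>real ^ 'n\<close> is \<open>\<Union>K\<close>.
  By \<open>face_of_convex_hull_affine_independent\<close> the faces of a simplex in the sense
  of \<^const>\<open>face_of\<close> are the convex hulls of the subsets of its vertex set.\<close>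

definition facet_complex :: "'a::euclidean_space set set \<Rightarrow> bool" where
  "facet_complex K \<longleftrightarrow>
     finite K \<and>
     (\<forall>\<sigma>\<in>K. \<exists>d::nat. int d simplex \<sigma>) \<and>
     (\<forall>\<sigma>\<in>K. \<forall>\<tau>\<in>K. (\<sigma> \<inter> \<tau>) face_of \<sigma> \<and> (\<sigma> \<inter> \<tau>) face_of \<tau>) \<and>
     (\<forall>\<sigma>\<in>K. \<forall>\<tau>\<in>K. \<sigma> \<noteq> \<tau> \<longrightarrow> \<not> \<sigma> \<subseteq> \<tau>)"

definition has_dimension :: "'a::euclidean_space set set \<Rightarrow> nat \<Rightarrow> bool" where
  "has_dimension K d \<longleftrightarrow>
     (\<exists>\<sigma>\<in>K. aff_dim \<sigma> = int d) \<and> (\<forall>\<sigma>\<in>K. aff_dim \<sigma> \<le> int d)"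

definition simplex_vertices :: "'a::euclidean_space set \<Rightarrow> 'a set" where
  "simplex_vertices \<sigma> = \<Union>{C. \<not> affine_dependent C \<and> \<sigma> = convex hull C}"

lemma simplex_vertices_convex_hull [simp]:
  assumes "\<not> affine_dependent C"
  shows "simplex_vertices (convex hull C) = C"
proof -
  have "D = C" if D: "\<not> affine_dependent D" and eq: "convex hull C = convex hull D" for D
    using extreme_point_of_convex_hull_affine_independent[OF assms]
      extreme_point_of_convex_hull_affine_independent[OF D] unfolding eq by blast
  then show ?thesis
    using assms unfolding simplex_vertices_def by blast
qed

definition complex_vertices :: "'a::euclidean_space set set \<Rightarrow> 'a set" where
  "complex_vertices K = (\<Union>\<sigma>\<in>K. simplex_vertices \<sigma>)"

definition complex_edges :: "'a::euclidean_space set set \<Rightarrow> 'a set set" where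
  "complex_edges K = {\<sigma>\<in>K. 1 simplex \<sigma>}"

definition isolated_vertices :: "'a::euclidean_space set set \<Rightarrow> 'a set" where
  "isolated_vertices K =
     {w \<in> complex_vertices K. \<forall>\<sigma>\<in>complex_edges K. w \<notin> simplex_vertices \<sigma>}"


section \<open>Piecewise polynomial functions\<close>

text \<open>Functions on the underlying set \<open>\<Union>K\<close> are represented by total functions on \<open>real ^ 'n\<close>
  whose values outside \<open>\<Union>K\<close> are irrelevant: no notion below depends on them, and equality of
  functions is always stated pointwise on \<open>\<Union>K\<close>.\<close>

definition represents ::
    "(real ^ 'n) set set \<Rightarrow> ((real ^ 'n) set \<Rightarrow> 'n::finite mpoly) \<Rightarrow> (real ^ 'n \<Rightarrow> real) \<Rightarrow> bool" where
  "represents K f F \<longleftrightarrow> (\<forall>\<sigma>\<in>K. \<forall>x\<in>\<sigma>. F x = peval (f \<sigma>) x)"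

definition C0 :: "(real ^ 'n::finite) set set \<Rightarrow> (real ^ 'n \<Rightarrow> real) set" where
  "C0 K = {F. continuous_on (\<Union>K) F \<and> (\<exists>g. represents K g F)}"

definition pw_degree :: "(real ^ 'n::finite) set set \<Rightarrow> (real ^ 'n \<Rightarrow> real) \<Rightarrow> nat" where
  "pw_degree K F =
     (LEAST d. \<exists>f. represents K f F \<and> d = Max ((\<lambda>\<sigma>. total_degree (f \<sigma>)) ` K))"

definition tent_function ::
    "(real ^ 'n::finite) set set \<Rightarrow> real ^ 'n \<Rightarrow> (real ^ 'n \<Rightarrow> real) \<Rightarrow> bool" where
  "tent_function K w T \<longleftrightarrow>
     T \<in> C0 K \<and>
     (\<forall>\<sigma>\<in>K. \<exists>a b. \<forall>x\<in>\<sigma>. T x = a \<bullet> x + b) \<and>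
     T w = 1 \<and>
     (\<forall>u\<in>complex_vertices K. u \<noteq> w \<longrightarrow> T u = 0)"

text \<open>\<open>S\<close> is a sum of \<open>N\<close> squares of elements of \<open>C0 K\<close>; some of these may be zero, so that
  this also covers sums of fewer than \<open>N\<close> squares.\<close>

definition sum_of_squares ::
    "(real ^ 'n::finite) set set \<Rightarrow> nat \<Rightarrow> (real ^ 'n \<Rightarrow> real) \<Rightarrow> bool" where
  "sum_of_squares K N S \<longleftrightarrow>
     (\<exists>h. (\<forall>l<N. h l \<in> C0 K) \<and> (\<forall>x\<in>\<Union>K. S x = (\<Sum>l<N. (h l x)\<^sup>2)))"


section \<open>Existence and uniqueness of the tent functions\<close>

lemma peval_superset:
  assumes "finite A" "Poly_Mapping.keys p \<subseteq> A"
  shows "peval p x = (\<Sum>a\<in>A. Poly_Mapping.lookup p a * (\<Prod>i\<in>UNIV. (x $ i) ^ Poly_Mapping.lookup a i))"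
  unfolding peval_def using assms
  by (intro sum.mono_neutral_left) (auto simp: in_keys_iff)

lemma peval_add: "peval (p + q) x = peval p x + peval q x"
proof -
  let ?A = "Poly_Mapping.keys p \<union> Poly_Mapping.keys q"
  have "Poly_Mapping.keys (p + q) \<subseteq> ?A" by (rule keys_add)
  then show ?thesis
    by (simp add: peval_superset[of ?A] lookup_add algebra_simps sum.distrib)
qed

lemma peval_0 [simp]: "peval 0 x = 0"
  by (simp add: peval_def)

lemma peval_sum: "peval (sum f A) x = (\<Sum>a\<in>A. peval (f a) x)"
  by (induction A rule: infinite_finite_induct) (auto simp: peval_add)

lemma peval_single:
  "peval (Poly_Mapping.single a c) x = c * (\<Prod>i\<in>UNIV. (x $ i) ^ Poly_Mapping.lookup a i)"
  by (simp add: peval_superset[of "{a}"])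

lemma peval_affine: "\<exists>p. \<forall>x :: real ^ 'n::finite. peval p x = a \<bullet> x + b"
proof -
  define p :: "'n mpoly" where
    "p = (\<Sum>i\<in>UNIV. Poly_Mapping.single (Poly_Mapping.single i 1) (a $ i)) + Poly_Mapping.single 0 b"
  have mono: "(\<Prod>j\<in>UNIV. (x $ j) ^ Poly_Mapping.lookup (Poly_Mapping.single i (1::nat)) j) = x $ i"
    for x :: "real ^ 'n" and i
  proof -
    have "(\<Prod>j\<in>UNIV. (x $ j) ^ Poly_Mapping.lookup (Poly_Mapping.single i (1::nat)) j) =
          (\<Prod>j\<in>UNIV. if j = i then x $ j else 1)"
      by (rule prod.cong) (auto simp: lookup_single when_def)
    then show ?thesis by simp
  qed
  have "peval p x = a \<bullet> x + b" for x
    unfolding p_def peval_add peval_sum peval_single mono by (simp add: inner_vec_def)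
  then show ?thesis by blast
qed

lemma affine_interpolation:
  fixes C :: "'a::euclidean_space set"
  assumes "\<not> affine_dependent C"
  shows "\<exists>a b. \<forall>c\<in>C. a \<bullet> c + b = (g c :: real)"
proof (cases "C = {}")
  case False
  then obtain c0 where c0: "c0 \<in> C" by blast
  have "independent ((\<lambda>x. - c0 + x) ` (C - {c0}))"
    using assms affine_dependent_iff_dependent2[OF c0] by blast
  from linear_independent_extend[OF this, of "\<lambda>y. g (y + c0) - g c0"]
  obtain f where f: "linear f"
    "\<forall>y\<in>(\<lambda>x. - c0 + x) ` (C - {c0}). f y = g (y + c0) - g c0" by blast
  have inner: "x \<bullet> adjoint f 1 = f x" for x
    using adjoint_works[OF f(1), of x 1] by simp
  have "adjoint f 1 \<bullet> c + (g c0 - f c0) = g c" if "c \<in> C" for c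
  proof (cases "c = c0")
    case True
    then show ?thesis using inner by (simp add: inner_commute)
  next
    case False
    then have "f (- c0 + c) = g c - g c0"
      using f(2) that by force
    moreover have "f (- c0 + c) = f c - f c0"
      using linear_diff[OF f(1), of c c0] by simp
    ultimately show ?thesis using inner[of c] by (simp add: inner_commute)
  qed
  then show ?thesis by blast
qed simp

lemma affine_eq_on_convex_hull:
  fixes a a' :: "'a::euclidean_space"
  assumes "x \<in> convex hull C" "\<And>c. c \<in> C \<Longrightarrow> a \<bullet> c + b = a' \<bullet> c + b'"
  shows "a \<bullet> x + b = a' \<bullet> x + b'"
proof -
  have "convex {x. (a - a') \<bullet> x = b' - b}" by (rule convex_hyperplane)
  moreover have "C \<subseteq> {x. (a - a') \<bullet> x = b' - b}"
    using assms(2) by (force simp: inner_diff_left algebra_simps)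
  ultimately have "x \<in> {x. (a - a') \<bullet> x = b' - b}"
    using assms(1) hull_minimal[of C _ convex] by blast
  then show ?thesis by (simp add: inner_diff_left algebra_simps)
qed

lemma facet_complex_simplex:
  assumes "facet_complex K" "\<sigma> \<in> K"
  shows "\<not> affine_dependent (simplex_vertices \<sigma>)" "\<sigma> = convex hull (simplex_vertices \<sigma>)"
proof -
  obtain C where C: "\<not> affine_dependent C" "\<sigma> = convex hull C"
    using assms unfolding facet_complex_def simplex_def by meson
  then show "\<not> affine_dependent (simplex_vertices \<sigma>)" "\<sigma> = convex hull (simplex_vertices \<sigma>)"
    using simplex_vertices_convex_hull[OF C(1)] unfolding C(2) by simp_all
qed

lemma tent_function_unique:
  assumes K: "facet_complex K" and T: "tent_function K w T" "tent_function K w T'"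
    and x: "x \<in> \<Union>K"
  shows "T x = T' x"
proof -
  obtain \<sigma> where \<sigma>: "\<sigma> \<in> K" "x \<in> \<sigma>" using x by blast
  note hull = facet_complex_simplex(2)[OF K \<sigma>(1)]
  obtain a b where ab: "\<forall>x\<in>\<sigma>. T x = a \<bullet> x + b"
    using T(1) \<sigma> unfolding tent_function_def by meson
  obtain a' b' where ab': "\<forall>x\<in>\<sigma>. T' x = a' \<bullet> x + b'"
    using T(2) \<sigma> unfolding tent_function_def by meson
  have "a \<bullet> c + b = a' \<bullet> c + b'" if "c \<in> simplex_vertices \<sigma>" for c
  proof -
    have "c \<in> \<sigma>" using hull_inc[OF that] hull by blast
    moreover have "c \<in> complex_vertices K" using that \<sigma> by (auto simp: complex_vertices_def)
    then have "T c = T' c" using T unfolding tent_function_def by (cases "c = w") auto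
    ultimately show ?thesis using ab ab' by simp
  qed
  then have "a \<bullet> x + b = a' \<bullet> x + b'"
    using affine_eq_on_convex_hull[of x "simplex_vertices \<sigma>"] \<sigma>(2) hull by blast
  then show ?thesis using ab ab' \<sigma> by simp
qed

lemma tent_function_exists:
  fixes K :: "(real ^ 'n::finite) set set"
  assumes K: "facet_complex K" and w: "w \<in> complex_vertices K"
  shows "\<exists>T. tent_function K w T"
proof -
  have "\<forall>\<sigma>\<in>K. \<exists>a b. \<forall>c\<in>simplex_vertices \<sigma>. a \<bullet> c + b = (if c = w then 1 else 0 :: real)"
    by (intro ballI affine_interpolation facet_complex_simplex(1)[OF K])
  then obtain a b where ab:
    "\<And>\<sigma> c. \<sigma> \<in> K \<Longrightarrow> c \<in> simplex_vertices \<sigma> \<Longrightarrow> a \<sigma> \<bullet> c + b \<sigma> = (if c = w then 1 else 0 :: real)"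
    by metis
  have agree: "a \<sigma> \<bullet> x + b \<sigma> = a \<tau> \<bullet> x + b \<tau>"
    if "\<sigma> \<in> K" "\<tau> \<in> K" "x \<in> \<sigma>" "x \<in> \<tau>" for \<sigma> \<tau> x
  proof -
    have face: "(\<sigma> \<inter> \<tau>) face_of \<rho> \<Longrightarrow> \<rho> \<in> K \<Longrightarrow>
        \<exists>c \<subseteq> simplex_vertices \<rho>. \<sigma> \<inter> \<tau> = convex hull c" for \<rho>
      using face_of_convex_hull_affine_independent[OF facet_complex_simplex(1)[OF K], of \<rho>]
        facet_complex_simplex(2)[OF K, of \<rho>] by auto
    have ff: "(\<sigma> \<inter> \<tau>) face_of \<sigma>" "(\<sigma> \<inter> \<tau>) face_of \<tau>"
      using K that unfolding facet_complex_def by blast+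
    note K\<sigma> = that(1) and K\<tau> = that(2)
    obtain c where c: "c \<subseteq> simplex_vertices \<sigma>" "\<sigma> \<inter> \<tau> = convex hull c"
      using face[OF ff(1) K\<sigma>] by blast
    obtain d where d: "d \<subseteq> simplex_vertices \<tau>" "\<sigma> \<inter> \<tau> = convex hull d"
      using face[OF ff(2) K\<tau>] by blast
    have cd: "\<not> affine_dependent c" "\<not> affine_dependent d"
      using c(1) d(1) facet_complex_simplex(1)[OF K] that affine_independent_subset by blast+
    have "c = d"
      using simplex_vertices_convex_hull[OF cd(1)] simplex_vertices_convex_hull[OF cd(2)]
      unfolding c(2)[symmetric] d(2)[symmetric] by (rule trans[OF sym])
    then have "c \<subseteq> simplex_vertices \<tau>" using d(1) by simp
    moreover have "x \<in> convex hull c" using c(2) that by auto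
    moreover have "a \<sigma> \<bullet> u + b \<sigma> = a \<tau> \<bullet> u + b \<tau>" if "u \<in> c" for u
      using trans[OF ab[OF K\<sigma>] sym[OF ab[OF K\<tau>]]] that c(1)
        \<open>c \<subseteq> simplex_vertices \<tau>\<close> by blast
    ultimately show ?thesis
      using affine_eq_on_convex_hull by blast
  qed
  define T where "T x = (let \<sigma> = (SOME \<sigma>. \<sigma> \<in> K \<and> x \<in> \<sigma>) in a \<sigma> \<bullet> x + b \<sigma>)" for x
  have T: "T x = a \<sigma> \<bullet> x + b \<sigma>" if "\<sigma> \<in> K" "x \<in> \<sigma>" for \<sigma> x
  proof -
    have "(SOME \<sigma>. \<sigma> \<in> K \<and> x \<in> \<sigma>) \<in> K \<and> x \<in> (SOME \<sigma>. \<sigma> \<in> K \<and> x \<in> \<sigma>)"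
      by (rule someI[of "\<lambda>\<sigma>. \<sigma> \<in> K \<and> x \<in> \<sigma>" \<sigma>]) (use that in simp)
    then show ?thesis unfolding T_def Let_def using agree that by blast
  qed
  have vert: "T c = (if c = w then 1 else 0)" if cK: "c \<in> complex_vertices K" for c
  proof -
    obtain \<sigma> where \<sigma>: "\<sigma> \<in> K" "c \<in> simplex_vertices \<sigma>"
      using cK by (auto simp: complex_vertices_def)
    then have "c \<in> \<sigma>"
      using facet_complex_simplex(2)[OF K \<sigma>(1)] hull_inc[OF \<sigma>(2)] by blast
    then show ?thesis using trans[OF T ab] \<sigma> by blast
  qed
  have "continuous_on (\<Union>\<sigma>\<in>K. \<sigma>) T"
  proof (rule continuous_on_closed_Union)
    show "finite K" using K by (simp add: facet_complex_def)
    show "closed \<sigma>" if "\<sigma> \<in> K" for \<sigma>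
      using that K closed_simplex unfolding facet_complex_def by blast
    show "continuous_on \<sigma> T" if "\<sigma> \<in> K" for \<sigma>
    proof -
      have "continuous_on \<sigma> (\<lambda>x. a \<sigma> \<bullet> x + b \<sigma>)" by (intro continuous_intros)
      then show ?thesis using T[OF that] by (simp cong: continuous_on_cong)
    qed
  qed
  moreover have "\<exists>g. represents K g T"
  proof -
    have "\<forall>\<sigma>. \<exists>p. \<forall>x. peval p x = a \<sigma> \<bullet> x + b \<sigma>" using peval_affine by blast
    then obtain g where "\<forall>\<sigma> x. peval (g \<sigma>) x = a \<sigma> \<bullet> x + b \<sigma>" by metis
    then have "represents K g T" using T unfolding represents_def by simp
    then show ?thesis by blast
  qed
  ultimately have "T \<in> C0 K" by (simp add: C0_def)
  then have "tent_function K w T"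
    unfolding tent_function_def using T vert w by auto
  then show ?thesis by blast
qed

end

theory Submission
  imports Defs "HOL-Computational_Algebra.Fundamental_Theorem_Algebra"
begin

text \<open>On an edge parametrized by \<open>t \<in> [0,1]\<close> the product of the two tent functions is \<open>t (1 - t)\<close>, and
  it vanishes on all other facets. By Lukacs' theorem a polynomial that is nonnegative on \<open>[0,1]\<close> is
  \<open>p\<^sup>2 + t (1 - t) q\<^sup>2\<close>, where \<open>p\<close> can be chosen nonnegative at both endpoints at the cost of a slightly
  larger degree. Then \<open>p\<close> takes the value \<open>sqrt (F w)\<close> at each endpoint \<open>w\<close>, so the \<open>p\<close> of all
  edges glue to one element \<open>h\<close> of \<open>C0 K\<close>, while each \<open>q\<close> extends arbitrarily. Hence a single square
  \<open>S = h\<^sup>2\<close> and single squares \<open>S\<^sub>i\<^sub>j\<close> suffice.\<close>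

section \<open>Nonnegative polynomials on the unit interval\<close>

text \<open>The degree of \<open>q\<close> is bounded through \<open>X * q\<close>, since \<open>degree q \<le> k - 1\<close> would wrongly admit
  nonzero constants \<open>q\<close> for \<open>k = 0\<close>. Both forms are norm forms, hence multiplicative with additive
  degree bounds.\<close>

definition even_lukacs :: "nat \<Rightarrow> real poly \<Rightarrow> bool" where
  "even_lukacs k f \<longleftrightarrow>
     (\<exists>p q. f = p\<^sup>2 + [:0, 1:] * [:1, -1:] * q\<^sup>2 \<and> degree p \<le> k \<and> degree ([:0, 1:] * q) \<le> k)"

definition odd_lukacs :: "nat \<Rightarrow> real poly \<Rightarrow> bool" where
  "odd_lukacs k f \<longleftrightarrow>
     (\<exists>p q. f = [:0, 1:] * p\<^sup>2 + [:1, -1:] * q\<^sup>2 \<and> degree p \<le> k \<and> degree q \<le> k)"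

text \<open>The parity of the index selects the form, and with k = d div 2 both summands have degree
  at most d. Leading terms may cancel, so the index is only a bound for the degree, and such bounds
  add under multiplication.\<close>

definition lukacs :: "nat \<Rightarrow> real poly \<Rightarrow> bool" where
  "lukacs d f \<longleftrightarrow> (if even d then even_lukacs (d div 2) f else odd_lukacs (d div 2) f)"

section \<open>Multiplicativity of the even and odd forms\<close>

lemma degree_mult_le_add: "degree p \<le> a \<Longrightarrow> degree q \<le> b \<Longrightarrow> degree (p * q) \<le> a + b"
  by (meson add_mono degree_mult_le order_trans)

text \<open>The even form bounds \<open>[:0, 1:] * q\<close>; this transfers the bound to
  \<open>[:1, -1:] * q\<close>, which the product identities also contain.\<close>

lemma degree_mult_one_minus_X: "degree ([:1, -1:] * q) = degree ([:0, 1:] * (q :: real poly))"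
  by (cases "q = 0") (auto simp: degree_mult_eq simp del: mult_pCons_left)

lemma even_lukacs_mult:
  assumes "even_lukacs k f" "even_lukacs l g"
  shows "even_lukacs (k + l) (f * g)"
proof -
  obtain p q where f: "f = p\<^sup>2 + [:0, 1:] * [:1, -1:] * q\<^sup>2" "degree p \<le> k" "degree ([:0, 1:] * q) \<le> k"
    using assms(1) unfolding even_lukacs_def by blast
  obtain u w where g: "g = u\<^sup>2 + [:0, 1:] * [:1, -1:] * w\<^sup>2" "degree u \<le> l" "degree ([:0, 1:] * w) \<le> l"
    using assms(2) unfolding even_lukacs_def by blast
  \<comment> \<open>Brahmagupta's identity. Abstract t and s keep the concrete polynomials X and 1 -
    X from being expanded, and grouping t s q w as (t q)(s w) fits the degree bounds.\<close>
  have eq: "(p\<^sup>2 + t * s * q\<^sup>2) * (u\<^sup>2 + t * s * w\<^sup>2) =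
      (p * u - (t * q) * (s * w))\<^sup>2 + t * s * (p * w + q * u)\<^sup>2" for t s :: "real poly"
    by (simp add: algebra_simps power2_eq_square)
  have "degree (p * u - ([:0, 1:] * q) * ([:1, -1:] * w)) \<le> k + l"
    using f g by (intro degree_diff_le degree_mult_le_add) (simp_all only: degree_mult_one_minus_X)
  moreover have "[:0, 1:] * (p * w + q * u) = p * ([:0, 1:] * w) + ([:0, 1:] * q) * u"
    by (simp only: distrib_left ac_simps)
  then have "degree ([:0, 1:] * (p * w + q * u)) \<le> k + l"
    using f g by (simp only:) (intro degree_add_le degree_mult_le_add)
  ultimately show ?thesis
    unfolding even_lukacs_def f(1) g(1) eq by blast
qed

lemma even_odd_lukacs_mult:
  assumes "even_lukacs k f" "odd_lukacs l g"
  shows "odd_lukacs (k + l) (f * g)"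
proof -
  obtain p q where f: "f = p\<^sup>2 + [:0, 1:] * [:1, -1:] * q\<^sup>2" "degree p \<le> k" "degree ([:0, 1:] * q) \<le> k"
    using assms(1) unfolding even_lukacs_def by blast
  obtain u w where g: "g = [:0, 1:] * u\<^sup>2 + [:1, -1:] * w\<^sup>2" "degree u \<le> l" "degree w \<le> l"
    using assms(2) unfolding odd_lukacs_def by blast
  have eq: "(p\<^sup>2 + t * s * q\<^sup>2) * (t * u\<^sup>2 + s * w\<^sup>2) =
      t * (p * u - (s * q) * w)\<^sup>2 + s * (p * w + (t * q) * u)\<^sup>2" for t s :: "real poly"
    by (simp add: algebra_simps power2_eq_square)
  have "degree (p * u - ([:1, -1:] * q) * w) \<le> k + l"
    using f g by (intro degree_diff_le degree_mult_le_add) (simp_all only: degree_mult_one_minus_X)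
  moreover have "degree (p * w + ([:0, 1:] * q) * u) \<le> k + l"
    using f g by (intro degree_add_le degree_mult_le_add)
  ultimately show ?thesis
    unfolding odd_lukacs_def f(1) g(1) eq by blast
qed

text \<open>The root t p u + s q w has an extra linear factor on p u and q w; this is the source of
  \<open>Suc\<close>.\<close>

lemma odd_lukacs_mult:
  assumes "odd_lukacs k f" "odd_lukacs l g"
  shows "even_lukacs (Suc (k + l)) (f * g)"
proof -
  obtain p q where f: "f = [:0, 1:] * p\<^sup>2 + [:1, -1:] * q\<^sup>2" "degree p \<le> k" "degree q \<le> k"
    using assms(1) unfolding odd_lukacs_def by blast
  obtain u w where g: "g = [:0, 1:] * u\<^sup>2 + [:1, -1:] * w\<^sup>2" "degree u \<le> l" "degree w \<le> l"
    using assms(2) unfolding odd_lukacs_def by blast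
  have eq: "(t * p\<^sup>2 + s * q\<^sup>2) * (t * u\<^sup>2 + s * w\<^sup>2) =
      (t * (p * u) + s * (q * w))\<^sup>2 + t * s * (p * w - q * u)\<^sup>2" for t s :: "real poly"
    by (simp add: algebra_simps power2_eq_square)
  have deg: "degree ([:c, d:] * h) \<le> Suc (k + l)" if "degree h \<le> k + l" for c d :: real and h
    using degree_mult_le_add[of "[:c, d:]" 1 h "k + l"] that by simp
  have "degree ([:0, 1:] * (p * u) + [:1, -1:] * (q * w)) \<le> Suc (k + l)"
    using f g by (intro degree_add_le deg degree_mult_le_add)
  moreover have "degree ([:0, 1:] * (p * w - q * u)) \<le> Suc (k + l)"
    using f g by (intro deg degree_diff_le degree_mult_le_add)
  ultimately show ?thesis
    unfolding even_lukacs_def f(1) g(1) eq by blast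
qed

text \<open>Only parity bookkeeping remains: halving loses a unit exactly when both indices are odd,
  and that unit is the \<open>Suc\<close> in \<open>odd_lukacs_mult\<close>.\<close>

lemma lukacs_mult:
  assumes "lukacs c f" "lukacs d g"
  shows "lukacs (c + d) (f * g)"
proof (cases "even c"; cases "even d")
  assume "even c" "even d"
  with assms show ?thesis
    by (auto simp: lukacs_def div_add dest: even_lukacs_mult)
next
  assume *: "even c" "odd d"
  then have "(c + d) div 2 = c div 2 + d div 2" by presburger
  with assms * show ?thesis
    by (auto simp: lukacs_def dest: even_odd_lukacs_mult)
next
  assume *: "odd c" "even d"
  then have "(c + d) div 2 = d div 2 + c div 2" by presburger
  with assms * show ?thesis
    using even_odd_lukacs_mult[of "d div 2" g "c div 2" f] by (auto simp: lukacs_def mult.commute)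
next
  assume *: "odd c" "odd d"
  then have "(c + d) div 2 = Suc (c div 2 + d div 2)" by presburger
  with assms * show ?thesis
    by (auto simp: lukacs_def dest: odd_lukacs_mult)
qed

section \<open>Constant, linear and quadratic factors\<close>

lemma lukacs_const: "0 \<le> c \<Longrightarrow> lukacs 0 [:c:]"
proof -
  assume "0 \<le> c"
  then have "[:c:] = [:sqrt c:]\<^sup>2 + [:0, 1:] * [:1, -1:] * 0\<^sup>2"
    by (simp add: power2_eq_square)
  then have "even_lukacs 0 [:c:]"
    unfolding even_lukacs_def by (intro exI[of _ "[:sqrt c:]"] exI[of _ 0]) auto
  then show ?thesis by (simp add: lukacs_def)
qed

text \<open>A linear f equals f(1) t + f(0) (1 - t), where both coefficients are
  non-negative.\<close>

lemma lukacs_linear: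
  assumes "0 \<le> a" "0 \<le> a + b"
  shows "lukacs 1 [:a, b:]"
proof -
  have "[:a, b:] = [:0, 1:] * [:sqrt (a + b):]\<^sup>2 + [:1, -1:] * [:sqrt a:]\<^sup>2"
    using assms by (simp add: power2_eq_square)
  then have "odd_lukacs 0 [:a, b:]"
    unfolding odd_lukacs_def by (intro exI[of _ "[:sqrt (a + b):]"] exI[of _ "[:sqrt a:]"]) auto
  then show ?thesis by (simp add: lukacs_def)
qed

lemma lukacs_square: "lukacs 2 ([:a, b:]\<^sup>2)"
proof -
  have "even_lukacs 1 ([:a, b:]\<^sup>2)"
    unfolding even_lukacs_def by (intro exI[of _ "[:a, b:]"] exI[of _ 0]) auto
  then show ?thesis by (simp add: lukacs_def)
qed

text \<open>The polynomial is f = (t - a)^2 + b^2, and y^2, x^2 are its values at 0 and 1. The line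
  from -y to x has a square agreeing with f at both ends, so the difference is a multiple of t (1 -
  t); leading coefficients give the factor (x + y)^2 - 1. It is non-negative because x + y is at
  least |1 - a| + |a|. The opposite signs of the end values are what makes this work.\<close>

lemma lukacs_quadratic: "lukacs 2 [:a\<^sup>2 + b\<^sup>2, -2 * a, 1:]"
proof -
  define y x where "y = sqrt (a\<^sup>2 + b\<^sup>2)" and "x = sqrt ((1 - a)\<^sup>2 + b\<^sup>2)"
  have "\<bar>a\<bar> \<le> y" "\<bar>1 - a\<bar> \<le> x"
    unfolding x_def y_def by (rule real_le_rsqrt; simp)+
  then have "1 \<le> x + y" by linarith
  then have c: "0 \<le> (x + y)\<^sup>2 - 1" by simp
  have xy: "y\<^sup>2 = a\<^sup>2 + b\<^sup>2" "x\<^sup>2 = (1 - a)\<^sup>2 + b\<^sup>2"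
    unfolding x_def y_def by simp_all
  define z where "z = sqrt ((x + y)\<^sup>2 - 1)"
  have z: "z\<^sup>2 = (x + y)\<^sup>2 - 1" unfolding z_def using c by simp
  have "[:a\<^sup>2 + b\<^sup>2, -2 * a, 1:] = [:- y, x + y:]\<^sup>2 + [:0, 1:] * [:1, -1:] * [:z:]\<^sup>2"
    using xy z by (simp add: power2_eq_square algebra_simps)
  then have "even_lukacs 1 [:a\<^sup>2 + b\<^sup>2, -2 * a, 1:]"
    unfolding even_lukacs_def by (intro exI[of _ "[:- y, x + y:]"] exI[of _ "[:z:]"]) auto
  then show ?thesis by (simp add: lukacs_def)
qed

section \<open>Dividing out real and complex roots, and Lukacs' theorem\<close>

lemma poly_nonneg_removable:
  fixes g :: "real poly"
  assumes "a < b" "x \<in> {a..b}" "\<And>x. x \<in> {a..b} \<Longrightarrow> x \<noteq> r \<Longrightarrow> 0 \<le> poly g x"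
  shows "0 \<le> poly g x"
proof (cases "x = r")
  case True
  have "(poly g \<longlongrightarrow> poly g x) (at x within {a..b})"
    by (intro tendsto_eq_intros) auto
  moreover have "eventually (\<lambda>y. 0 \<le> poly g y) (at x within {a..b})"
    using assms(3) True by (auto simp: eventually_at_filter)
  moreover have "at x within {a..b} \<noteq> bot"
    using assms(1,2) islimpt_Icc[of a b x] by (simp add: trivial_limit_within)
  ultimately show ?thesis by (metis tendsto_lowerbound)
qed (use assms in auto)

lemma real_poly_eq_0_if_complex_root:
  assumes "poly (map_poly complex_of_real r) z = 0" "Im z \<noteq> 0" "degree r \<le> 1"
  shows "r = 0"
proof -
  have "r = [:coeff r 0, coeff r 1:]"
    using assms(3) by (intro poly_eqI) (auto simp: coeff_pCons coeff_eq_0 split: nat.split)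
  then obtain a b where r: "r = [:a, b:]" by metis
  have "complex_of_real a + z * complex_of_real b = 0"
    using assms(1) by (cases "b = 0"; cases "a = 0") (auto simp: r map_poly_pCons)
  with assms(2) show ?thesis
    by (auto simp: complex_eq_iff r)
qed

text \<open>A complex root z = a + i b exists and is not real. The remainder modulo (X - z)(X - conj
  z) is real, has degree at most 1 and vanishes at z, so it is zero.\<close>

lemma real_poly_quadratic_factor:
  fixes f :: "real poly"
  assumes "0 < degree f" "\<And>x. poly f x \<noteq> 0"
  obtains a b g where "b \<noteq> 0" "f = [:a\<^sup>2 + b\<^sup>2, -2 * a, 1:] * g"
proof -
  let ?c = "map_poly complex_of_real"
  have "degree (?c f) = degree f" by (rule degree_map_poly) simp
  then have "\<not> constant (poly (?c f))"
    using assms(1) by (simp add: constant_degree)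
  then obtain z where z: "poly (?c f) z = 0"
    using fundamental_theorem_of_algebra by blast
  have mult: "?c (p * q) = ?c p * ?c q" for p q by (rule poly_eqI) (simp add: coeff_map_poly coeff_mult)
  have add: "?c (p + q) = ?c p + ?c q" for p q by (rule poly_eqI) (simp add: coeff_map_poly)
  have ev: "poly (?c p) (of_real x) = of_real (poly p x)" for p x
    by (induction p) (auto simp: map_poly_pCons)
  have Im: "Im z \<noteq> 0"
  proof
    assume "Im z = 0"
    then have "z = of_real (Re z)" by (simp add: complex_eq_iff)
    then have "of_real (poly f (Re z)) = (0 :: complex)" using z by (metis ev)
    then show False using assms(2) by simp
  qed
  define Q where "Q = [:(Re z)\<^sup>2 + (Im z)\<^sup>2, -2 * Re z, 1:]"
  have Qz: "poly (?c Q) z = 0"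
    unfolding Q_def by (simp add: map_poly_pCons complex_eq_iff power2_eq_square algebra_simps)
  have "f = Q * (f div Q) + f mod Q" by simp
  then have "?c f = ?c Q * ?c (f div Q) + ?c (f mod Q)" by (metis mult add)
  then have "poly (?c (f mod Q)) z = 0" using z Qz by simp
  moreover have "degree (f mod Q) \<le> 1"
    using degree_mod_less[of Q f] by (auto simp: Q_def)
  ultimately have "f mod Q = 0" using real_poly_eq_0_if_complex_root Im by blast
  then have "f = Q * (f div Q)" using \<open>f = Q * (f div Q) + f mod Q\<close> by simp
  then show ?thesis using that Im unfolding Q_def by blast
qed

text \<open>Induction on the degree, dividing out a factor that has a Lukacs form and is positive on
  [0,1] except perhaps at one point. It comes from a root outside (0,1), a double root inside, or a
  conjugate pair.\<close>

lemma lukacs_nonneg: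
  fixes f :: "real poly"
  assumes "\<And>x. x \<in> {0..1} \<Longrightarrow> 0 \<le> poly f x"
  shows "lukacs (degree f) f"
  using assms
proof (induction "degree f" arbitrary: f rule: less_induct)
  case less
  \<comment> \<open>The factor \<open>h\<close> may vanish at \<open>r\<close>; there the sign of
    \<open>g\<close> follows by continuity.\<close>
  have step: "lukacs (degree f) f"
    if f: "f = h * g" and h: "lukacs (degree h) h" "0 < degree h"
      and pos: "\<And>x. x \<in> {0..1} \<Longrightarrow> x \<noteq> r \<Longrightarrow> 0 < poly h x" for h g r
  proof (cases "g = 0")
    case True
    then show ?thesis using f lukacs_const[of 0] by simp
  next
    case False
    have "h \<noteq> 0" using h(2) by auto
    then have deg: "degree f = degree h + degree g" using f False by (simp add: degree_mult_eq)
    have "0 \<le> poly g x" if "x \<in> {0..1}" "x \<noteq> r" for x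
      using less.prems[OF that(1)] pos[OF that] by (simp add: f zero_le_mult_iff)
    then have "0 \<le> poly g x" if "x \<in> {0..1}" for x
      using poly_nonneg_removable[of 0 1 x r g] that by simp
    then have "lukacs (degree g) g" using less.hyps deg h(2) by simp
    then show ?thesis unfolding deg using lukacs_mult h(1) f by simp
  qed
  show ?case
  proof (cases "degree f = 0")
    case True
    then obtain c where "f = [:c:]" by (rule degree_eq_zeroE)
    then show ?thesis using less.prems[of 0] lukacs_const by simp
  next
    case nonconst: False
    show ?thesis
    proof (cases "\<exists>r. poly f r = 0")
      case True
      then obtain r where "poly f r = 0" by blast
      then obtain g where g: "f = [:- r, 1:] * g" by (metis dvdE poly_eq_0_iff_dvd)
      consider "r \<le> 0" | "1 \<le> r" | "0 < r" "r < 1" by linarith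
      then show ?thesis
      proof cases
        case 1
        show ?thesis
          by (rule step[of "[:- r, 1:]" g r]) (use g 1 lukacs_linear in auto)
      next
        case 2
        \<comment> \<open>Here X - r is negative on [0,1] away from \<open>r\<close>, so the sign is
          moved to the cofactor.\<close>
        show ?thesis
          by (rule step[of "[:r, - 1:]" "- g" r]) (use g 2 lukacs_linear[of r "-1"] in auto)
      next
        case 3
        \<comment> \<open>X - r changes sign at \<open>r\<close> while f does not. Hence g is
          non-negative on the right of \<open>r\<close> and non-positive on the left, so it vanishes
          at \<open>r\<close> and the root is at least double.\<close>
        have sgn: "0 \<le> (x - r) * poly g x" if "x \<in> {0..1}" for x
          using less.prems[OF that] by (simp add: g algebra_simps)
        have "0 \<le> poly g x" if "x \<in> {r..1}" "x \<noteq> r" for x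
          using sgn[of x] that 3 by (auto simp: zero_le_mult_iff)
        then have "0 \<le> poly g r"
          using poly_nonneg_removable[of r 1 r r g] 3 by simp
        moreover have "0 \<le> poly (- g) x" if "x \<in> {0..r}" "x \<noteq> r" for x
          using sgn[of x] that 3 by (auto simp: zero_le_mult_iff)
        then have "0 \<le> poly (- g) r"
          using poly_nonneg_removable[of 0 r r r "- g"] 3 by simp
        ultimately have "poly g r = 0" by simp
        then obtain g' where g': "g = [:- r, 1:] * g'" by (metis dvdE poly_eq_0_iff_dvd)
        have "f = [:- r, 1:]\<^sup>2 * g'" unfolding g g' by (simp only: power2_eq_square mult.assoc)
        moreover have "degree ([:- r, 1:]\<^sup>2) = 2" by (simp add: degree_power_eq)
        ultimately show ?thesis
          using lukacs_square[of "- r" 1] by (intro step[of "[:- r, 1:]\<^sup>2" g' r]) (auto simp: poly_power)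
      qed
    next
      case False
      then have "0 < degree f" "\<And>x. poly f x \<noteq> 0" using nonconst by auto
      then obtain a b g where ab: "b \<noteq> 0" "f = [:a\<^sup>2 + b\<^sup>2, -2 * a, 1:] * g"
        by (rule real_poly_quadratic_factor)
      have "poly [:a\<^sup>2 + b\<^sup>2, -2 * a, 1:] x = (x - a)\<^sup>2 + b\<^sup>2" for x
        by (simp add: power2_eq_square algebra_simps)
      moreover have "0 < (x - a)\<^sup>2 + b\<^sup>2" for x using ab(1) by (simp add: add_nonneg_pos)
      moreover have "degree [:a\<^sup>2 + b\<^sup>2, -2 * a, 1:] = 2" by simp
      ultimately show ?thesis
        using lukacs_quadratic[of a b] ab(2)
        by (intro step[of "[:a\<^sup>2 + b\<^sup>2, -2 * a, 1:]" g]) (simp_all only: zero_less_numeral)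
    qed
  qed
qed

text \<open>The flag \<open>s\<close> requests prescribed end values. Without it, an odd degree is
  rounded up by one. With it, the odd form is used throughout, which costs two for an even
  degree.\<close>

lemma lukacs_certificate:
  fixes f :: "real poly"
  assumes nonneg: "\<And>x. x \<in> {0..1} \<Longrightarrow> 0 \<le> poly f x" and "degree f \<le> d"
  obtains p q where "\<And>x. poly f x = (poly p x)\<^sup>2 + (1 - x) * x * (poly q x)\<^sup>2"
    "2 * degree p \<le> d + (if s then 2 else 1)" "2 * degree q \<le> d + (if s then 2 else 1)"
    "s \<Longrightarrow> poly p 0 = sqrt (poly f 0) \<and> poly p 1 = sqrt (poly f 1)"
proof -
  have luk: "lukacs (degree f) f" using nonneg by (rule lukacs_nonneg)
  txt \<open>The odd form \<open>X p\<^sup>2 + (1 - X) q\<^sup>2\<close> equals \<open>(X p + (1 - X) q)\<^sup>2 + X (1 - X) (p - q)\<^sup>2\<close>. The values of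
    the first square root at 1 and 0 are \<open>p(1)\<close> and \<open>q(0)\<close>, whose signs can be chosen independently.\<close>
  show ?thesis
  proof (cases "s \<or> odd (degree f)")
    case False
    then obtain p q where f: "f = p\<^sup>2 + [:0, 1:] * [:1, -1:] * q\<^sup>2"
      and deg: "degree p \<le> degree f div 2" "degree ([:0, 1:] * q) \<le> degree f div 2"
      using luk unfolding lukacs_def even_lukacs_def by auto
    have "degree q \<le> degree ([:0, 1:] * q)"
      by (cases "q = 0") auto
    then show ?thesis
      using False deg assms(2) by (intro that[of p q]) (auto simp: f poly_power algebra_simps)
  next
    case True
    define k where "k = degree f div 2"
    have "odd_lukacs k f"
    proof (cases "odd (degree f)")
      case True
      then show ?thesis using luk by (simp add: lukacs_def k_def)
    next
      case False
      then have "even_lukacs k f" using luk by (simp add: lukacs_def k_def)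
      \<comment> \<open>1 = X + (1 - X) has the odd form with constant roots, so multiplying by it
        turns the even form into the odd one for the same k.\<close>
      moreover have "odd_lukacs 0 1"
        using lukacs_linear[of 1 0] by (simp add: lukacs_def one_pCons)
      ultimately show ?thesis using even_odd_lukacs_mult[of k f 0 1] by simp
    qed
    then obtain p q where f: "f = [:0, 1:] * p\<^sup>2 + [:1, -1:] * q\<^sup>2"
      and deg: "degree p \<le> k" "degree q \<le> k"
      unfolding odd_lukacs_def by blast
    define p' where "p' = (if 0 \<le> poly p 1 then p else - p)"
    define q' where "q' = (if 0 \<le> poly q 0 then q else - q)"
    have f': "f = [:0, 1:] * p'\<^sup>2 + [:1, -1:] * q'\<^sup>2"
      by (simp add: f p'_def q'_def)
    have deg': "degree p' \<le> k" "degree q' \<le> k"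
      using deg by (simp_all add: p'_def q'_def)
    have k: "2 * (1 + k) \<le> d + (if s then 2 else 1)"
      using True assms(2) unfolding k_def by (cases "odd (degree f)") (auto elim!: oddE)
    have "poly p' 1 = sqrt (poly f 1)" "poly q' 0 = sqrt (poly f 0)"
      by (auto simp: f p'_def q'_def poly_power)
    moreover have "degree ([:c, e:] * h) \<le> 1 + k" if "degree h \<le> k" for c e :: real and h
      using that by (intro degree_mult_le_add) simp_all
    then have "degree ([:0, 1:] * p' + [:1, -1:] * q') \<le> 1 + k" "degree (p' - q') \<le> k"
      using deg' by (blast intro: degree_add_le degree_diff_le)+
    ultimately show ?thesis
      using k
      by (intro that[of "[:0, 1:] * p' + [:1, -1:] * q'" "p' - q'"])
        (auto simp: f' poly_power power2_eq_square algebra_simps)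
  qed
qed

section \<open>Polynomials in several variables\<close>

lemma total_degree_le_iff:
  "total_degree p \<le> d \<longleftrightarrow> (\<forall>a\<in>Poly_Mapping.keys p. (\<Sum>i\<in>UNIV. Poly_Mapping.lookup a i) \<le> d)"
  unfolding total_degree_def by (subst Max_le_iff) auto

lemma total_degree_add_le:
  "total_degree p \<le> d \<Longrightarrow> total_degree q \<le> d \<Longrightarrow> total_degree (p + q) \<le> d"
  using keys_add[of p q] unfolding total_degree_le_iff by blast

lemma total_degree_sum_le:
  "(\<And>a. a \<in> A \<Longrightarrow> total_degree (f a) \<le> d) \<Longrightarrow> total_degree (sum f A) \<le> d"
  by (induction A rule: infinite_finite_induct)
    (auto intro: total_degree_add_le simp: total_degree_le_iff[of 0])

lemma total_degree_mult_le:
  assumes "total_degree p \<le> c" "total_degree q \<le> d"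
  shows "total_degree (p * q) \<le> c + d"
  unfolding total_degree_le_iff
proof
  fix a assume "a \<in> Poly_Mapping.keys (p * q)"
  then obtain b c' where "a = b + c'" "b \<in> Poly_Mapping.keys p" "c' \<in> Poly_Mapping.keys q"
    using keys_mult[of p q] by blast
  then show "(\<Sum>i\<in>UNIV. Poly_Mapping.lookup a i) \<le> c + d"
    using assms unfolding total_degree_le_iff by (simp add: lookup_add sum.distrib add_mono)
qed

lemma total_degree_single:
  "total_degree (Poly_Mapping.single a c) \<le> (\<Sum>i\<in>UNIV. Poly_Mapping.lookup a i)"
  by (simp add: total_degree_le_iff)

lemma mpoly_sum_monomials:
  "(\<Sum>a\<in>Poly_Mapping.keys p. Poly_Mapping.single a (Poly_Mapping.lookup p a)) = p"
  by (rule poly_mapping_eqI)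
    (auto simp: lookup_sum lookup_single when_def in_keys_iff)

text \<open>Expanding both factors into monomials reduces this to the addition of exponents.\<close>

lemma peval_mult: "peval (p * q) x = peval p x * peval q x"
proof -
  have "p * q = (\<Sum>a\<in>Poly_Mapping.keys p. Poly_Mapping.single a (Poly_Mapping.lookup p a)) *
      (\<Sum>b\<in>Poly_Mapping.keys q. Poly_Mapping.single b (Poly_Mapping.lookup q b))"
    by (simp only: mpoly_sum_monomials)
  also have "\<dots> = (\<Sum>a\<in>Poly_Mapping.keys p. \<Sum>b\<in>Poly_Mapping.keys q.
      Poly_Mapping.single (a + b) (Poly_Mapping.lookup p a * Poly_Mapping.lookup q b))"
    by (simp add: sum_product mult_single)
  finally show ?thesis
    by (simp add: peval_sum peval_single peval_def[of p] peval_def[of q] sum_product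
        lookup_add power_add prod.distrib mult_ac)
qed

text \<open>Adds a degree bound to \<open>peval_affine\<close>, for which the polynomial must be
  explicit.\<close>

lemma affine_mpoly:
  fixes a :: "real ^ 'n::finite"
  obtains p where "total_degree p \<le> 1" "\<And>x. peval p x = a \<bullet> x + b"
proof
  let ?X = "\<lambda>i::'n. Poly_Mapping.single i (1::nat)"
  let ?p = "(\<Sum>i\<in>UNIV. Poly_Mapping.single (?X i) (a $ i)) + Poly_Mapping.single 0 b"
  have prod: "(\<Prod>j\<in>UNIV. (x $ j) ^ Poly_Mapping.lookup (?X i) j) = x $ i" for x :: "real ^ 'n" and i
  proof -
    have "(\<Prod>j\<in>UNIV. (x $ j) ^ Poly_Mapping.lookup (?X i) j) = (\<Prod>j\<in>UNIV. if j = i then x $ j else 1)"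
      by (rule prod.cong) (auto simp: lookup_single when_def)
    then show ?thesis by simp
  qed
  show "peval ?p x = a \<bullet> x + b" for x
    unfolding peval_add peval_sum peval_single prod by (simp add: inner_vec_def)
  have "total_degree (Poly_Mapping.single (?X i) (a $ i)) \<le> 1" for i
    using total_degree_single[of "?X i" "a $ i"] by (simp add: lookup_single when_def)
  moreover have "total_degree (Poly_Mapping.single (0 :: 'n \<Rightarrow>\<^sub>0 nat) b) \<le> 1"
    using total_degree_single[of "0 :: 'n \<Rightarrow>\<^sub>0 nat" b] by simp
  ultimately show "total_degree ?p \<le> 1"
    by (intro total_degree_add_le total_degree_sum_le)
qed

text \<open>Horner's scheme: each step multiplies by a polynomial of degree at most 1 and adds a
  constant.\<close>

lemma poly_compose_affine_mpoly:
  fixes a :: "real ^ 'n::finite"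
  obtains p where "total_degree p \<le> degree q" "\<And>x. peval p x = poly q (a \<bullet> x + b)"
proof -
  have "\<exists>p. total_degree p \<le> degree q \<and> (\<forall>x. peval p x = poly q (a \<bullet> x + b))"
  proof (induction q)
    case 0
    have "total_degree (0 :: 'n mpoly) \<le> 0" unfolding total_degree_le_iff by simp
    then show ?case by (metis degree_0 peval_0 poly_0)
  next
    case (pCons c q)
    obtain l where l: "total_degree l \<le> 1" "\<And>x. peval l x = a \<bullet> x + b"
      using affine_mpoly[of a b] by blast
    obtain k :: "'n mpoly" where k: "total_degree k \<le> 0" "\<And>x. peval k x = c"
    proof
      show "total_degree (Poly_Mapping.single 0 c :: 'n mpoly) \<le> 0"
        using total_degree_single[of "0 :: 'n \<Rightarrow>\<^sub>0 nat" c] by simp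
    qed (simp add: peval_single)
    obtain p where p: "total_degree p \<le> degree q" "\<And>x. peval p x = poly q (a \<bullet> x + b)"
      using pCons.IH by blast
    show ?case
    \<comment> \<open>For \<open>q = 0\<close> the degree of \<open>pCons c q\<close> stays 0,
      whereas \<open>k + l * p\<close> would only be bounded by 1.\<close>
    proof (cases "q = 0")
      case True
      then show ?thesis using k by auto
    next
      case False
      then have "total_degree (k + l * p) \<le> degree (pCons c q)"
        using total_degree_mult_le[OF l(1) p(1)] k(1) by (intro total_degree_add_le) auto
      then show ?thesis
        using k(2) l(2) p(2) by (intro exI[of _ "k + l * p"]) (simp add: peval_add peval_mult)
    qed
  qed
  then show ?thesis using that by blast
qed

section \<open>Restriction to segments and pulling certificates back\<close>

lemma degree_prod_le:
  assumes "\<And>i. i \<in> A \<Longrightarrow> degree (f i) \<le> g i"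
  shows "degree (\<Prod>i\<in>A. f i) \<le> (\<Sum>i\<in>A. g i)"
  using assms by (induction A rule: infinite_finite_induct) (auto intro: degree_mult_le_add)

text \<open>Substituting a linear polynomial for each coordinate turns a monomial into a product of
  as many linear factors as its total degree.\<close>

lemma poly_restrict_line:
  fixes a b :: "real ^ 'n::finite"
  obtains g where "degree g \<le> total_degree p" "\<And>t. poly g t = peval p ((1 - t) *\<^sub>R a + t *\<^sub>R b)"
proof
  let ?g = "\<Sum>c\<in>Poly_Mapping.keys p. smult (Poly_Mapping.lookup p c)
    (\<Prod>i\<in>UNIV. [:a $ i, b $ i - a $ i:] ^ Poly_Mapping.lookup c i)"
  show "poly ?g t = peval p ((1 - t) *\<^sub>R a + t *\<^sub>R b)" for t
    by (simp add: peval_def poly_sum poly_prod poly_power algebra_simps)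
  have "degree ([:r, s:] ^ n) \<le> n" for r s :: real and n
    using degree_power_le[of "[:r, s:]" n] by (auto split: if_splits)
  then have "degree (\<Prod>i\<in>UNIV. [:a $ i, b $ i - a $ i:] ^ Poly_Mapping.lookup c i) \<le> total_degree p"
    if "c \<in> Poly_Mapping.keys p" for c
    using total_degree_le_iff[of p "total_degree p"] that by (blast intro: degree_prod_le order_trans)
  then show "degree ?g \<le> total_degree p"
    by (intro degree_sum_le) (auto intro: order_trans[OF degree_smult_le])
qed

text \<open>The affine function c x + k recovers the parameter of a point on the segment, so the
  univariate roots pull back along it without raising the degree.\<close>

lemma segment_certificate:
  fixes a b c :: "real ^ 'n::finite"
  assumes nonneg: "\<And>x. x \<in> closed_segment a b \<Longrightarrow> 0 \<le> peval f x" and "total_degree f \<le> d"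
    and l: "c \<bullet> a + k = 0" "c \<bullet> b + k = 1"
  obtains P Q where
    "\<And>x. x \<in> closed_segment a b \<Longrightarrow>
      peval f x = (peval P x)\<^sup>2 + (1 - (c \<bullet> x + k)) * (c \<bullet> x + k) * (peval Q x)\<^sup>2"
    "2 * total_degree P \<le> d + (if s then 2 else 1)" "2 * total_degree Q \<le> d + (if s then 2 else 1)"
    "s \<Longrightarrow> peval P a = sqrt (peval f a) \<and> peval P b = sqrt (peval f b)"
proof -
  obtain g where g: "degree g \<le> total_degree f" "\<And>t. poly g t = peval f ((1 - t) *\<^sub>R a + t *\<^sub>R b)"
    using poly_restrict_line[of f a b] by blast
  have "0 \<le> poly g t" if "t \<in> {0..1}" for t
    unfolding g(2) using that by (intro nonneg) (auto simp: in_segment)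
  then obtain p q where pq: "\<And>t. poly g t = (poly p t)\<^sup>2 + (1 - t) * t * (poly q t)\<^sup>2"
    "2 * degree p \<le> d + (if s then 2 else 1)" "2 * degree q \<le> d + (if s then 2 else 1)"
    "s \<Longrightarrow> poly p 0 = sqrt (poly g 0) \<and> poly p 1 = sqrt (poly g 1)"
    using lukacs_certificate[of g d s] g(1) assms(2) by auto
  obtain P where P: "total_degree P \<le> degree p" "\<And>x. peval P x = poly p (c \<bullet> x + k)"
    using poly_compose_affine_mpoly[of p c k] by blast
  obtain Q where Q: "total_degree Q \<le> degree q" "\<And>x. peval Q x = poly q (c \<bullet> x + k)"
    using poly_compose_affine_mpoly[of q c k] by blast
  have "peval f x = poly g (c \<bullet> x + k)" if x: "x \<in> closed_segment a b" for x
  proof -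
    obtain t where t: "x = (1 - t) *\<^sub>R a + t *\<^sub>R b" using x by (auto simp: in_segment)
    have "c \<bullet> x + k = (1 - t) * (c \<bullet> a + k) + t * (c \<bullet> b + k)"
      unfolding t by (simp add: inner_add_right algebra_simps)
    then have "c \<bullet> x + k = t" using l by simp
    then show ?thesis by (simp only: g(2) t)
  qed
  then have "peval f x = (peval P x)\<^sup>2 + (1 - (c \<bullet> x + k)) * (c \<bullet> x + k) * (peval Q x)\<^sup>2"
    if "x \<in> closed_segment a b" for x
    using that by (simp only: P(2) Q(2) pq(1))
  moreover have "peval P a = sqrt (peval f a) \<and> peval P b = sqrt (peval f b)" if s
    using pq(4)[OF that] by (simp add: P(2) l g(2))
  ultimately show ?thesis
    using that[of P Q] P(1) Q(1) pq(2,3) by fastforce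
qed

section \<open>One-dimensional complexes\<close>

lemma simplex_vertices_singleton [simp]: "simplex_vertices {w} = {w}"
  using simplex_vertices_convex_hull[of "{w}"] by simp

lemma simplex_vertices_subset:
  "facet_complex K \<Longrightarrow> \<sigma> \<in> K \<Longrightarrow> simplex_vertices \<sigma> \<subseteq> \<sigma>"
  by (metis facet_complex_simplex(2) hull_subset)

lemma complex_edge_segment:
  assumes "\<sigma> \<in> complex_edges K"
  obtains a b where "a \<noteq> b" "simplex_vertices \<sigma> = {a, b}" "\<sigma> = closed_segment a b"
proof -
  obtain C where C: "\<not> affine_dependent C" "card C = 2" "\<sigma> = convex hull C"
    using assms unfolding complex_edges_def simplex_def by auto
  then obtain a b where "C = {a, b}" "a \<noteq> b" by (auto simp: card_2_iff)
  with C show ?thesis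
    using that simplex_vertices_convex_hull[OF C(1)] by (simp add: segment_convex_hull)
qed

lemma one_dimensional_facet_cases:
  assumes "facet_complex K" "has_dimension K 1" "\<sigma> \<in> K"
  obtains "\<sigma> \<in> complex_edges K" | w where "\<sigma> \<notin> complex_edges K" "\<sigma> = {w}"
proof -
  obtain d :: nat where d: "int d simplex \<sigma>"
    using assms unfolding facet_complex_def by meson
  have "int d \<le> 1"
    using assms(2,3) aff_dim_simplex[OF d] unfolding has_dimension_def by auto
  then have "d = 0 \<or> d = 1" by auto
  then show ?thesis
    using that d assms(3) by (auto simp: complex_edges_def simplex_zero)
qed

lemma complex_edges_nonempty:
  assumes "facet_complex K" "has_dimension K 1"
  shows "complex_edges K \<noteq> {}"
proof -
  obtain \<sigma> where \<sigma>: "\<sigma> \<in> K" "aff_dim \<sigma> = 1"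
    using assms(2) unfolding has_dimension_def by auto
  then show ?thesis
    using one_dimensional_facet_cases[OF assms \<sigma>(1)] by (metis aff_dim_sing empty_iff zero_neq_one)
qed

text \<open>On an edge the intersection is a proper face, because no facet contains another. It is
  therefore spanned by at most one endpoint.\<close>

lemma facets_meet_in_vertices:
  assumes K: "facet_complex K" "has_dimension K 1"
    and \<sigma>: "\<sigma> \<in> K" and \<tau>: "\<tau> \<in> K" "\<sigma> \<noteq> \<tau>" and x: "x \<in> \<sigma>" "x \<in> \<tau>"
  shows "x \<in> simplex_vertices \<sigma>"
  using K \<sigma>
proof (cases rule: one_dimensional_facet_cases)
  case 1
  obtain a b where ab: "simplex_vertices \<sigma> = {a, b}"
    using complex_edge_segment[OF 1] by metis
  have "(\<sigma> \<inter> \<tau>) face_of \<sigma>"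
    using K(1) \<sigma> \<tau> unfolding facet_complex_def by blast
  then obtain c where c: "c \<subseteq> {a, b}" "\<sigma> \<inter> \<tau> = convex hull c"
    using face_of_convex_hull_affine_independent[OF facet_complex_simplex(1)[OF K(1) \<sigma>]]
      facet_complex_simplex(2)[OF K(1) \<sigma>] ab by metis
  have "\<not> \<sigma> \<subseteq> \<tau>" using K(1) \<sigma> \<tau> unfolding facet_complex_def by blast
  then have "c \<noteq> {a, b}" using c(2) facet_complex_simplex(2)[OF K(1) \<sigma>] ab by auto
  then have "c \<subseteq> {a} \<or> c \<subseteq> {b}" using c(1) by blast
  then have "convex hull c \<subseteq> {a} \<or> convex hull c \<subseteq> {b}"
    using hull_mono[of c "{a}" convex] hull_mono[of c "{b}" convex] by auto
  then show ?thesis using c x ab by blast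
next
  case (2 w)
  then show ?thesis using x by simp
qed

section \<open>Gluing polynomial pieces along vertices\<close>

lemma C0_glue:
  assumes K: "facet_complex K" "has_dimension K 1"
    and val: "\<And>\<sigma> c. \<sigma> \<in> K \<Longrightarrow> c \<in> simplex_vertices \<sigma> \<Longrightarrow> peval (g \<sigma>) c = val c"
  obtains h where "h \<in> C0 K" "represents K g h"
proof -
  \<comment> \<open>Distinct facets meet only in common vertices, where both pieces take the value
    \<open>val\<close>.\<close>
  have agree: "peval (g \<sigma>) x = peval (g \<tau>) x"
    if "\<sigma> \<in> K" "\<tau> \<in> K" "x \<in> \<sigma>" "x \<in> \<tau>" for \<sigma> \<tau> x
  proof (cases "\<sigma> = \<tau>")
    case False
    then show ?thesis
      using val[of \<sigma> x] val[of \<tau> x] facets_meet_in_vertices[OF K, of \<sigma> \<tau> x]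
        facets_meet_in_vertices[OF K, of \<tau> \<sigma> x] that by simp
  qed simp
  define h where "h x = peval (g (SOME \<sigma>. \<sigma> \<in> K \<and> x \<in> \<sigma>)) x" for x
  have h: "h x = peval (g \<sigma>) x" if "\<sigma> \<in> K" "x \<in> \<sigma>" for \<sigma> x
  proof -
    have "(SOME \<sigma>. \<sigma> \<in> K \<and> x \<in> \<sigma>) \<in> K \<and> x \<in> (SOME \<sigma>. \<sigma> \<in> K \<and> x \<in> \<sigma>)"
      by (rule someI[of _ \<sigma>]) (use that in simp)
    then show ?thesis unfolding h_def using agree that by blast
  qed
  have "continuous_on (\<Union>\<sigma>\<in>K. \<sigma>) h"
  proof (rule continuous_on_closed_Union)
    show "finite K" using K by (simp add: facet_complex_def)
    show "closed \<sigma>" if "\<sigma> \<in> K" for \<sigma>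
      using that K closed_simplex unfolding facet_complex_def by blast
    show "continuous_on \<sigma> h" if "\<sigma> \<in> K" for \<sigma>
    proof -
      have "continuous_on \<sigma> (peval (g \<sigma>))" unfolding peval_def by (intro continuous_intros)
      then show ?thesis using h[OF that] by (simp cong: continuous_on_cong)
    qed
  qed
  moreover have "represents K g h" using h by (simp add: represents_def)
  ultimately show ?thesis using that by (auto simp: C0_def)
qed

text \<open>Fills the facets on which only vertex values matter. Degree 0 on isolated points is
  essential: for one edge and constant F, the final bound on twice the degree is just 1.\<close>

lemma vertex_interpolation:
  fixes K :: "(real ^ 'n::finite) set set"
  assumes K: "facet_complex K" "has_dimension K 1" "\<sigma> \<in> K"
  shows "\<exists>p. total_degree p \<le> (if \<sigma> \<in> complex_edges K then 1 else 0) \<and>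
      (\<forall>c\<in>simplex_vertices \<sigma>. peval p c = val c)"
  using K
proof (cases rule: one_dimensional_facet_cases)
  case 1
  obtain a b where "\<forall>c\<in>simplex_vertices \<sigma>. a \<bullet> c + b = val c"
    using affine_interpolation[OF facet_complex_simplex(1)[OF K(1,3)]] by blast
  then show ?thesis using 1 affine_mpoly[of a b] by metis
next
  case (2 w)
  have "total_degree (Poly_Mapping.single 0 (val w)) \<le> 0"
    using total_degree_single[of 0 "val w"] by simp
  then show ?thesis
    using 2 by (intro exI[of _ "Poly_Mapping.single 0 (val w)"]) (simp add: peval_single)
qed

section \<open>Piecewise degrees and sums of squares\<close>

lemma pw_degree_le:
  assumes "finite K" "K \<noteq> {}" "represents K f S" "\<And>\<sigma>. \<sigma> \<in> K \<Longrightarrow> total_degree (f \<sigma>) \<le> D"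
  shows "pw_degree K S \<le> D"
proof -
  have "pw_degree K S \<le> Max ((\<lambda>\<sigma>. total_degree (f \<sigma>)) ` K)"
    unfolding pw_degree_def by (rule Least_le) (use assms(3) in blast)
  also have "\<dots> \<le> D" using assms by simp
  finally show ?thesis .
qed

lemma pw_degree_attained:
  assumes "finite K" "F \<in> C0 K"
  obtains f where "represents K f F" "\<And>\<sigma>. \<sigma> \<in> K \<Longrightarrow> total_degree (f \<sigma>) \<le> pw_degree K F"
proof -
  let ?P = "\<lambda>d. \<exists>f. represents K f F \<and> d = Max ((\<lambda>\<sigma>. total_degree (f \<sigma>)) ` K)"
  obtain g where "represents K g F" using assms(2) by (auto simp: C0_def)
  then have "?P (Max ((\<lambda>\<sigma>. total_degree (g \<sigma>)) ` K))" by blast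
  then have "?P (pw_degree K F)" unfolding pw_degree_def by (rule LeastI)
  then show ?thesis using that assms(1) by auto
qed

text \<open>Bounding twice the degree matches the certificates and avoids rounding for odd
  \<open>D\<close>.\<close>

lemma pw_degree_square_le:
  assumes "finite K" "K \<noteq> {}" "represents K g h" "\<And>\<sigma>. \<sigma> \<in> K \<Longrightarrow> 2 * total_degree (g \<sigma>) \<le> D"
  shows "pw_degree K (\<lambda>x. (h x)\<^sup>2) \<le> D"
proof (rule pw_degree_le[OF assms(1,2), of "\<lambda>\<sigma>. g \<sigma> * g \<sigma>"])
  show "represents K (\<lambda>\<sigma>. g \<sigma> * g \<sigma>) (\<lambda>x. (h x)\<^sup>2)"
    using assms(3) by (simp add: represents_def peval_mult power2_eq_square)
  show "total_degree (g \<sigma> * g \<sigma>) \<le> D" if "\<sigma> \<in> K" for \<sigma>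
    using total_degree_mult_le[OF order_refl order_refl, of "g \<sigma>" "g \<sigma>"] assms(4)[OF that] by linarith
qed

lemma sum_of_squares_square:
  assumes "h \<in> C0 K" "1 \<le> N"
  shows "sum_of_squares K N (\<lambda>x. (h x)\<^sup>2)"
proof -
  have "(\<lambda>x. 0) \<in> C0 K"
    unfolding C0_def represents_def by (auto intro!: exI[of _ "\<lambda>_. 0"])
  moreover have "(h x)\<^sup>2 = (\<Sum>l<N. ((if l = 0 then h else (\<lambda>x. 0)) x)\<^sup>2)" for x
  proof -
    have "(\<Sum>l<N. ((if l = 0 then h else (\<lambda>x. 0)) x)\<^sup>2) = (\<Sum>l<N. if l = 0 then (h x)\<^sup>2 else 0)"
      by (rule sum.cong) auto
    then show ?thesis using assms(2) by simp
  qed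
  ultimately show ?thesis
    unfolding sum_of_squares_def using assms(1)
    by (intro exI[of _ "\<lambda>l. if l = 0 then h else (\<lambda>x. 0)"]) auto
qed

lemma sum_of_squares_nonneg: "sum_of_squares K N S \<Longrightarrow> x \<in> \<Union>K \<Longrightarrow> 0 \<le> S x"
  unfolding sum_of_squares_def by (auto simp: sum_nonneg)

section \<open>Values of tent functions on facets\<close>

lemma tent_function_on_simplex:
  assumes K: "facet_complex K" and T: "tent_function K w T" and \<sigma>: "\<sigma> \<in> K"
  obtains a b where "\<And>x. x \<in> \<sigma> \<Longrightarrow> T x = a \<bullet> x + b"
    "\<And>c. c \<in> simplex_vertices \<sigma> \<Longrightarrow> a \<bullet> c + b = (if c = w then 1 else 0)"
proof -
  obtain a b where ab: "\<forall>x\<in>\<sigma>. T x = a \<bullet> x + b"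
    using T \<sigma> unfolding tent_function_def by meson
  have "a \<bullet> c + b = (if c = w then 1 else 0)" if c: "c \<in> simplex_vertices \<sigma>" for c
  proof -
    have "c \<in> complex_vertices K" using c \<sigma> by (auto simp: complex_vertices_def)
    then have "T c = (if c = w then 1 else 0)" using T by (auto simp: tent_function_def)
    then show ?thesis using ab simplex_vertices_subset[OF K \<sigma>] c by auto
  qed
  then show ?thesis using that ab by blast
qed

text \<open>On a facet T is affine and non-negative at the vertices; the corresponding half-space is
  convex and thus contains their hull.\<close>

lemma tent_function_nonneg:
  assumes K: "facet_complex K" and T: "tent_function K w T" and x: "x \<in> \<Union>K"
  shows "0 \<le> T x"
proof -
  obtain \<sigma> where \<sigma>: "\<sigma> \<in> K" "x \<in> \<sigma>" using x by blast
  obtain a b where ab: "\<And>x. x \<in> \<sigma> \<Longrightarrow> T x = a \<bullet> x + b"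
    "\<And>c. c \<in> simplex_vertices \<sigma> \<Longrightarrow> a \<bullet> c + b = (if c = w then 1 else 0)"
    using tent_function_on_simplex[OF K T \<sigma>(1)] by blast
  have "simplex_vertices \<sigma> \<subseteq> {y. a \<bullet> y \<ge> - b}"
  proof
    fix c assume "c \<in> simplex_vertices \<sigma>"
    then have "a \<bullet> c + b \<ge> 0" using ab(2) by simp
    then show "c \<in> {y. a \<bullet> y \<ge> - b}" by simp
  qed
  then have "convex hull (simplex_vertices \<sigma>) \<subseteq> {y. a \<bullet> y \<ge> - b}"
    by (rule hull_minimal) (rule convex_halfspace_ge)
  then show ?thesis using ab(1) \<sigma> facet_complex_simplex(2)[OF K \<sigma>(1)] by force
qed

lemma tent_function_eq_0:
  assumes K: "facet_complex K" and T: "tent_function K w T"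
    and \<sigma>: "\<sigma> \<in> K" "x \<in> \<sigma>" "w \<notin> simplex_vertices \<sigma>"
  shows "T x = 0"
proof -
  obtain a b where ab: "\<And>x. x \<in> \<sigma> \<Longrightarrow> T x = a \<bullet> x + b"
    "\<And>c. c \<in> simplex_vertices \<sigma> \<Longrightarrow> a \<bullet> c + b = (if c = w then 1 else 0)"
    using tent_function_on_simplex[OF K T \<sigma>(1)] by blast
  have "a \<bullet> x + b = 0 \<bullet> x + 0"
    by (rule affine_eq_on_convex_hull[of x "simplex_vertices \<sigma>"])
      (use ab(2) \<sigma> facet_complex_simplex(2)[OF K \<sigma>(1)] in auto)
  then show ?thesis using ab(1) \<sigma>(2) by simp
qed

section \<open>Certificates on edges and their assembly\<close>

lemma edge_certificate:
  fixes K :: "(real ^ 'n::finite) set set"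
  assumes K: "facet_complex K" and \<sigma>: "\<sigma> \<in> complex_edges K" "simplex_vertices \<sigma> = {u, w}" "u \<noteq> w"
    and U: "tent_function K u U" and W: "tent_function K w W"
    and f: "represents K f F" "total_degree (f \<sigma>) \<le> d" and nonneg: "\<forall>x\<in>\<sigma>. 0 \<le> F x"
  obtains P Q where "\<And>x. x \<in> \<sigma> \<Longrightarrow> F x = (peval P x)\<^sup>2 + (peval Q x)\<^sup>2 * U x * W x"
    "2 * total_degree P \<le> d + (if s then 2 else 1)" "2 * total_degree Q \<le> d + (if s then 2 else 1)"
    "\<And>c. s \<Longrightarrow> c \<in> simplex_vertices \<sigma> \<Longrightarrow> peval P c = sqrt (F c)"
proof -
  have \<sigma>K: "\<sigma> \<in> K" using \<sigma>(1) by (simp add: complex_edges_def)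
  note hull = facet_complex_simplex(2)[OF K \<sigma>K, unfolded \<sigma>(2)]
  have seg: "\<sigma> = closed_segment u w" using hull by (simp add: segment_convex_hull)
  obtain a b where ab: "\<And>x. x \<in> \<sigma> \<Longrightarrow> U x = a \<bullet> x + b"
    "\<And>c. c \<in> simplex_vertices \<sigma> \<Longrightarrow> a \<bullet> c + b = (if c = u then 1 else 0)"
    using tent_function_on_simplex[OF K U \<sigma>K] by blast
  obtain c k where ck: "\<And>x. x \<in> \<sigma> \<Longrightarrow> W x = c \<bullet> x + k"
    "\<And>y. y \<in> simplex_vertices \<sigma> \<Longrightarrow> c \<bullet> y + k = (if y = w then 1 else 0)"
    using tent_function_on_simplex[OF K W \<sigma>K] by blast
  \<comment> \<open>Both sides are affine and agree at the two endpoints. With W as the coordinate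
    t, the weight t (1 - t) becomes U W.\<close>
  have UW: "U x = 1 - W x" if "x \<in> \<sigma>" for x
  proof -
    have "a \<bullet> x + b = (- c) \<bullet> x + (1 - k)"
    proof (rule affine_eq_on_convex_hull)
      show "x \<in> convex hull {u, w}" using that hull by simp
      fix y assume "y \<in> {u, w}"
      then show "a \<bullet> y + b = (- c) \<bullet> y + (1 - k)"
        using ab(2)[of y] ck(2)[of y] \<sigma>(2,3) by auto
    qed
    then show ?thesis using ab(1) ck(1) that by simp
  qed
  have F: "F x = peval (f \<sigma>) x" if "x \<in> \<sigma>" for x using f(1) \<sigma>K that by (simp add: represents_def)
  have "0 \<le> peval (f \<sigma>) x" if "x \<in> closed_segment u w" for x
    using F nonneg that seg by metis
  moreover have "c \<bullet> u + k = 0" "c \<bullet> w + k = 1" using ck(2) \<sigma>(2,3) by auto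
  ultimately obtain P Q where PQ: "\<And>x. x \<in> closed_segment u w \<Longrightarrow>
      peval (f \<sigma>) x = (peval P x)\<^sup>2 + (1 - (c \<bullet> x + k)) * (c \<bullet> x + k) * (peval Q x)\<^sup>2"
    "2 * total_degree P \<le> d + (if s then 2 else 1)" "2 * total_degree Q \<le> d + (if s then 2 else 1)"
    "s \<Longrightarrow> peval P u = sqrt (peval (f \<sigma>) u) \<and> peval P w = sqrt (peval (f \<sigma>) w)"
    using segment_certificate[of u w "f \<sigma>" d c k s] f(2) by metis
  have "F x = (peval P x)\<^sup>2 + (peval Q x)\<^sup>2 * U x * W x" if "x \<in> \<sigma>" for x
    using PQ(1)[of x] F UW ck(1) that seg by simp
  moreover have "peval P y = sqrt (F y)" if s "y \<in> simplex_vertices \<sigma>" for y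
    using PQ(4) that \<sigma>(2) F simplex_vertices_subset[OF K \<sigma>K] by auto
  ultimately show ?thesis using that PQ(2,3) by blast
qed

text \<open>A facet with at most two vertices that is not the edge of \<open>p\<close> misses an
  endpoint of that edge, and the tent function of the missing endpoint vanishes on it.\<close>

lemma tent_products_on_simplex:
  fixes K :: "(real ^ 'n::finite) set set"
    and v :: "nat \<Rightarrow> real ^ 'n"
  assumes K: "facet_complex K" and v: "inj_on v {1..m}"
    and T: "\<And>i. i \<in> {1..m} \<Longrightarrow> tent_function K (v i) (T i)"
    and E: "E = {(i, j). 1 \<le> i \<and> i < j \<and> j \<le> m \<and>
                (\<exists>\<sigma>\<in>complex_edges K. simplex_vertices \<sigma> = {v i, v j})}"
    and \<sigma>: "\<sigma> \<in> K" "x \<in> \<sigma>" and p: "p \<in> E" and V: "simplex_vertices \<sigma> \<noteq> {v (fst p), v (snd p)}"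
    and card: "card (simplex_vertices \<sigma>) \<le> 2"
  shows "T (fst p) x * T (snd p) x = 0"
proof -
  obtain i j where "p = (i, j)" "1 \<le> i" "i < j" "j \<le> m" using p unfolding E by blast
  then have p': "fst p \<in> {1..m}" "snd p \<in> {1..m}" "fst p \<noteq> snd p" by simp_all
  then have "card {v (fst p), v (snd p)} = 2" using inj_onD[OF v, of "fst p" "snd p"] by fastforce
  moreover have "finite (simplex_vertices \<sigma>)"
    using facet_complex_simplex(1)[OF K \<sigma>(1)] by (rule aff_independent_finite)
  ultimately have "\<not> {v (fst p), v (snd p)} \<subseteq> simplex_vertices \<sigma>"
    using V card card_seteq by metis
  then show ?thesis
    using tent_function_eq_0[OF K T \<sigma>] p' by auto
qed

lemma nonneg_certificate:
  fixes K :: "(real ^ 'n::finite) set set"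
    and v :: "nat \<Rightarrow> real ^ 'n"
  assumes K: "facet_complex K" "has_dimension K 1"
    and e: "e = card (complex_edges K)"
    and v: "bij_betw v {1..m} (complex_vertices K)"
    and E: "E = {(i, j). 1 \<le> i \<and> i < j \<and> j \<le> m \<and>
                (\<exists>\<sigma>\<in>complex_edges K. simplex_vertices \<sigma> = {v i, v j})}"
    and T: "\<And>i. i \<in> {1..m} \<Longrightarrow> tent_function K (v i) (T i)"
    and F: "F \<in> C0 K" and nonneg: "\<forall>x\<in>\<Union>K. F x \<ge> 0"
    and D: "D = pw_degree K F + 6 * (e - 1) + 1"
  obtains h q where "h \<in> C0 K" "pw_degree K (\<lambda>x. (h x)\<^sup>2) \<le> D"
    "\<And>i j. (i, j) \<in> E \<Longrightarrow> q i j \<in> C0 K \<and> pw_degree K (\<lambda>x. (q i j x)\<^sup>2) \<le> D"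
    "\<And>x. x \<in> \<Union>K \<Longrightarrow> F x = (h x)\<^sup>2 + (\<Sum>(i, j)\<in>E. (q i j x)\<^sup>2 * T i x * T j x)"
proof -
  \<comment> \<open>Several edges require matching end values, at a cost of up to two degrees;
    \<open>D\<close> then exceeds \<open>pw_degree K F\<close> by at least 7. For one edge it
    exceeds it by only 1.\<close>
  define s where "s \<longleftrightarrow> 1 < e"
  have fin: "finite K" using K(1) by (simp add: facet_complex_def)
  have edgeK: "\<sigma> \<in> K" if "\<sigma> \<in> complex_edges K" for \<sigma> using that by (simp add: complex_edges_def)
  have fin_edges: "finite (complex_edges K)" using fin by (simp add: complex_edges_def)
  obtain \<sigma>0 where \<sigma>0: "\<sigma>0 \<in> complex_edges K" using complex_edges_nonempty[OF K] by blast
  have Kne: "K \<noteq> {}" using edgeK[OF \<sigma>0] by blast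
  have e1: "1 \<le> e" using \<sigma>0 fin_edges e by (metis One_nat_def Suc_leI card_gt_0_iff empty_iff)
  have only: "\<sigma> = \<sigma>0" if "\<not> s" "\<sigma> \<in> complex_edges K" for \<sigma>
    using that e e1 \<sigma>0 by (metis card_1_singletonE le_antisym not_le s_def singletonD)
  have two: "2 \<le> D" if s using that by (simp add: s_def D)
  obtain f where f: "represents K f F" "\<And>\<sigma>. \<sigma> \<in> K \<Longrightarrow> total_degree (f \<sigma>) \<le> pw_degree K F"
    using pw_degree_attained[OF fin F] by blast
  have inj: "inj_on v {1..m}" using v by (rule bij_betw_imp_inj_on)
  \<comment> \<open>The order i < j lets the unordered set of endpoints determine the index
    pair.\<close>
  have uniq: "i = i' \<and> j = j'" if "(i, j) \<in> E" "(i', j') \<in> E" "{v i, v j} = {v i', v j'}" for i j i' j'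
  proof -
    have sub: "{i, j} \<subseteq> {1..m}" "{i', j'} \<subseteq> {1..m}" and "i < j" "i' < j'"
      using that unfolding E by auto
    have "v ` {i, j} = v ` {i', j'}" using that by simp
    then have "{i, j} = {i', j'}" by (simp only: inj_on_image_eq_iff[OF inj sub])
    then show ?thesis using \<open>i < j\<close> \<open>i' < j'\<close> by (metis doubleton_eq_iff order_less_asym)
  qed
  have edge_index: "\<exists>i j. (i, j) \<in> E \<and> simplex_vertices \<sigma> = {v i, v j}" if \<sigma>: "\<sigma> \<in> complex_edges K" for \<sigma>
  proof -
    obtain a b where ab: "a \<noteq> b" "simplex_vertices \<sigma> = {a, b}" using complex_edge_segment[OF \<sigma>] by metis
    have "{a, b} \<subseteq> v ` {1..m}"
      using ab(2) edgeK[OF \<sigma>] bij_betw_imp_surj_on[OF v] unfolding complex_vertices_def by blast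
    then obtain i j where ij: "i \<in> {1..m}" "j \<in> {1..m}" "a = v i" "b = v j" by auto
    then have "i \<noteq> j" using ab(1) by blast
    then have "i < j \<or> j < i" by linarith
    then show ?thesis
    proof
      assume "i < j"
      then have "(i, j) \<in> E" unfolding E using ij ab(2) \<sigma> by auto
      then show ?thesis using ij ab(2) by blast
    next
      assume "j < i"
      then have "(j, i) \<in> E" unfolding E using ij ab(2) \<sigma> by (auto simp: insert_commute)
      then show ?thesis using ij ab(2) by (metis insert_commute)
    qed
  qed
  \<comment> \<open>Quantifying over all index pairs of the edge leaves P and Q dependent on the
    edge alone, so they can be chosen edge by edge.\<close>
  define cert where "cert \<sigma> P Q \<longleftrightarrow> 2 * total_degree P \<le> D \<and> 2 * total_degree Q \<le> D \<and>
      (\<forall>c\<in>simplex_vertices \<sigma>. s \<longrightarrow> peval P c = sqrt (F c)) \<and>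
      (\<forall>i j. (i, j) \<in> E \<longrightarrow> simplex_vertices \<sigma> = {v i, v j} \<longrightarrow>
        (\<forall>x\<in>\<sigma>. F x = (peval P x)\<^sup>2 + (peval Q x)\<^sup>2 * T i x * T j x))" for \<sigma> P Q
  have "\<exists>P Q. cert \<sigma> P Q"
    if \<sigma>: "\<sigma> \<in> complex_edges K" for \<sigma>
  proof -
    obtain i j where ij: "(i, j) \<in> E" "simplex_vertices \<sigma> = {v i, v j}" using edge_index[OF \<sigma>] by blast
    have ij': "i \<in> {1..m}" "j \<in> {1..m}" "i \<noteq> j" using ij(1) unfolding E by auto
    then have ne: "v i \<noteq> v j" using inj_onD[OF inj, of i j] by blast
    have "\<forall>x\<in>\<sigma>. 0 \<le> F x" using nonneg edgeK[OF \<sigma>] by blast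
    then obtain P Q where PQ: "\<And>x. x \<in> \<sigma> \<Longrightarrow> F x = (peval P x)\<^sup>2 + (peval Q x)\<^sup>2 * T i x * T j x"
      "2 * total_degree P \<le> pw_degree K F + (if s then 2 else 1)"
      "2 * total_degree Q \<le> pw_degree K F + (if s then 2 else 1)"
      "\<And>c. s \<Longrightarrow> c \<in> simplex_vertices \<sigma> \<Longrightarrow> peval P c = sqrt (F c)"
      using edge_certificate[OF K(1) \<sigma> ij(2) ne T[OF ij'(1)] T[OF ij'(2)] f(1) f(2)[OF edgeK[OF \<sigma>]], of s]
      by blast
    have le: "pw_degree K F + (if s then 2 else 1) \<le> D" by (auto simp: D s_def)
    have unique: "i' = i \<and> j' = j" if "(i', j') \<in> E" "simplex_vertices \<sigma> = {v i', v j'}" for i' j'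
      using uniq ij that by metis
    have "cert \<sigma> P Q"
      unfolding cert_def
    proof (intro conjI ballI allI impI)
      show "2 * total_degree P \<le> D" "2 * total_degree Q \<le> D"
        using PQ(2,3) le by linarith+
    next
      fix i' j' x assume "(i', j') \<in> E" "simplex_vertices \<sigma> = {v i', v j'}" "x \<in> \<sigma>"
      then show "F x = (peval P x)\<^sup>2 + (peval Q x)\<^sup>2 * T i' x * T j' x"
        using PQ(1) unique[of i' j'] by simp
    qed (use PQ(4) in blast)
    then show ?thesis by blast
  qed
  then obtain P Q where "\<And>\<sigma>. \<sigma> \<in> complex_edges K \<Longrightarrow> cert \<sigma> (P \<sigma>) (Q \<sigma>)" by metis
  then have PQ: "\<And>\<sigma>. \<sigma> \<in> complex_edges K \<Longrightarrow> 2 * total_degree (P \<sigma>) \<le> D"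
    "\<And>\<sigma>. \<sigma> \<in> complex_edges K \<Longrightarrow> 2 * total_degree (Q \<sigma>) \<le> D"
    "\<And>\<sigma> c. \<sigma> \<in> complex_edges K \<Longrightarrow> c \<in> simplex_vertices \<sigma> \<Longrightarrow> s \<Longrightarrow> peval (P \<sigma>) c = sqrt (F c)"
    "\<And>\<sigma> i j x. \<sigma> \<in> complex_edges K \<Longrightarrow> (i, j) \<in> E \<Longrightarrow> simplex_vertices \<sigma> = {v i, v j} \<Longrightarrow> x \<in> \<sigma> \<Longrightarrow>
      F x = (peval (P \<sigma>) x)\<^sup>2 + (peval (Q \<sigma>) x)\<^sup>2 * T i x * T j x"
    unfolding cert_def by blast+

  \<comment> \<open>Prescribed pieces on the edges in \<open>A\<close> are completed by
    interpolating vertex values. All edges are prescribed for \<open>h\<close>, a single one for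
    each q. Since \<open>A\<close> is nonempty, an edge outside it forces several edges, and then
    \<open>D\<close> has room for the square of a linear piece.\<close>
  have extend: "\<exists>h g. h \<in> C0 K \<and> represents K g h \<and> (\<forall>\<sigma>\<in>A. g \<sigma> = p \<sigma>) \<and>
      (\<forall>\<sigma>\<in>K. \<forall>c\<in>simplex_vertices \<sigma>. peval (g \<sigma>) c = val c) \<and> (\<forall>\<sigma>\<in>K. 2 * total_degree (g \<sigma>) \<le> D)"
    if A: "A \<subseteq> complex_edges K" "A \<noteq> {}" and deg: "\<And>\<sigma>. \<sigma> \<in> A \<Longrightarrow> 2 * total_degree (p \<sigma>) \<le> D"
      and val: "\<And>\<sigma> c. \<sigma> \<in> A \<Longrightarrow> c \<in> simplex_vertices \<sigma> \<Longrightarrow> peval (p \<sigma>) c = val c"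
    for A :: "(real ^ 'n) set set" and p and val :: "real ^ 'n \<Rightarrow> real"
  proof -
    have "\<forall>\<sigma>\<in>K. \<exists>p. total_degree p \<le> (if \<sigma> \<in> complex_edges K then 1 else 0) \<and>
        (\<forall>c\<in>simplex_vertices \<sigma>. peval p c = val c)"
      by (rule ballI) (rule vertex_interpolation[OF K])
    from bchoice[OF this]
    obtain r where r: "\<And>\<sigma>. \<sigma> \<in> K \<Longrightarrow> total_degree (r \<sigma>) \<le> (if \<sigma> \<in> complex_edges K then 1 else 0)"
      "\<And>\<sigma> c. \<sigma> \<in> K \<Longrightarrow> c \<in> simplex_vertices \<sigma> \<Longrightarrow> peval (r \<sigma>) c = val c"
      by blast
    define g where "g \<sigma> = (if \<sigma> \<in> A then p \<sigma> else r \<sigma>)" for \<sigma>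
    have g: "\<And>\<sigma> c. \<sigma> \<in> K \<Longrightarrow> c \<in> simplex_vertices \<sigma> \<Longrightarrow> peval (g \<sigma>) c = val c"
      using val r(2) by (simp add: g_def)
    have "2 * total_degree (g \<sigma>) \<le> D" if \<sigma>: "\<sigma> \<in> K" for \<sigma>
    proof (cases "\<sigma> \<in> complex_edges K - A")
      case True
      have s using only A True by blast
      then show ?thesis using True r(1)[OF \<sigma>] two by (simp add: g_def)
    next
      case False
      then show ?thesis using deg r(1)[OF \<sigma>] by (auto simp: g_def)
    qed
    moreover obtain h where "h \<in> C0 K" "represents K g h" using C0_glue[OF K g] .
    ultimately show ?thesis using g by (auto intro!: exI[of _ h] exI[of _ g] simp: g_def)
  qed

  txt \<open>With a single edge nothing has to be glued, and the endpoint values of the univariate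
    certificate are kept, as prescribing them could cost one degree too much.\<close>
  define val where "val c = (if \<not> s \<and> c \<in> simplex_vertices \<sigma>0 then peval (P \<sigma>0) c else sqrt (F c))" for c
  have "peval (P \<sigma>) c = val c" if "\<sigma> \<in> complex_edges K" "c \<in> simplex_vertices \<sigma>" for \<sigma> c
    using PQ(3)[OF that] only[OF _ that(1)] that(2) by (cases s) (auto simp: val_def)
  then obtain h g where h: "h \<in> C0 K" "represents K g h" "\<And>\<sigma>. \<sigma> \<in> complex_edges K \<Longrightarrow> g \<sigma> = P \<sigma>"
    "\<And>\<sigma> c. \<sigma> \<in> K \<Longrightarrow> c \<in> simplex_vertices \<sigma> \<Longrightarrow> peval (g \<sigma>) c = val c"
    "\<And>\<sigma>. \<sigma> \<in> K \<Longrightarrow> 2 * total_degree (g \<sigma>) \<le> D"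
    using extend[of "complex_edges K" P val] \<sigma>0 PQ(1) by blast

  \<comment> \<open>Only the values on the edge of (i, j) matter, as the product of its two tent
    functions vanishes on all other facets.\<close>
  have "\<exists>q. q \<in> C0 K \<and> pw_degree K (\<lambda>x. (q x)\<^sup>2) \<le> D \<and>
      (\<forall>\<sigma>\<in>complex_edges K. simplex_vertices \<sigma> = {v i, v j} \<longrightarrow> (\<forall>x\<in>\<sigma>. q x = peval (Q \<sigma>) x))"
    if ij: "(i, j) \<in> E" for i j
  proof -
    obtain \<sigma> where \<sigma>: "\<sigma> \<in> complex_edges K" "simplex_vertices \<sigma> = {v i, v j}" using ij unfolding E by auto
    obtain q r where q: "q \<in> C0 K" "represents K r q" "r \<sigma> = Q \<sigma>" "\<forall>\<tau>\<in>K. 2 * total_degree (r \<tau>) \<le> D"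
      \<comment> \<open>Evaluating Q on the whole space supplies consistent values at all vertices,
        including those off the edge.\<close>
      using extend[of "{\<sigma>}" Q "peval (Q \<sigma>)"] \<sigma>(1) PQ(2) by auto
    have "\<tau> = \<sigma>" if "\<tau> \<in> complex_edges K" "simplex_vertices \<tau> = {v i, v j}" for \<tau>
      using facet_complex_simplex(2)[OF K(1) edgeK] that \<sigma> by metis
    moreover have "q x = peval (Q \<sigma>) x" if "x \<in> \<sigma>" for x
      using q(2,3) that edgeK[OF \<sigma>(1)] by (auto simp: represents_def)
    moreover have "pw_degree K (\<lambda>x. (q x)\<^sup>2) \<le> D"
      using pw_degree_square_le[OF fin Kne q(2)] q(4) by blast
    ultimately show ?thesis using q(1) by blast
  qed
  then obtain q where q: "\<And>i j. (i, j) \<in> E \<Longrightarrow> q i j \<in> C0 K"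
    "\<And>i j. (i, j) \<in> E \<Longrightarrow> pw_degree K (\<lambda>x. (q i j x)\<^sup>2) \<le> D"
    "\<And>i j \<sigma> x. (i, j) \<in> E \<Longrightarrow> \<sigma> \<in> complex_edges K \<Longrightarrow> simplex_vertices \<sigma> = {v i, v j} \<Longrightarrow> x \<in> \<sigma> \<Longrightarrow>
      q i j x = peval (Q \<sigma>) x"
    by metis

  have finE: "finite E"
    by (rule finite_subset[of _ "{1..m} \<times> {1..m}"]) (auto simp: E)
  have "F x = (h x)\<^sup>2 + (\<Sum>(i, j)\<in>E. (q i j x)\<^sup>2 * T i x * T j x)" if x: "x \<in> \<Union>K" for x
  proof -
    obtain \<sigma> where \<sigma>: "\<sigma> \<in> K" "x \<in> \<sigma>" using x by blast
    have hx: "h x = peval (g \<sigma>) x" using h(2) \<sigma> by (simp add: represents_def)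
    note zero = tent_products_on_simplex[OF K(1) inj T E \<sigma>]
    show ?thesis
      using K \<sigma>(1)
    proof (cases rule: one_dimensional_facet_cases)
      case 1
      obtain i j where ij: "(i, j) \<in> E" "simplex_vertices \<sigma> = {v i, v j}" using edge_index[OF 1] by blast
      have "card (simplex_vertices \<sigma>) \<le> 2" using ij(2) by (simp add: card_insert_if)
      then have "T (fst p) x * T (snd p) x = 0" if "p \<in> E - {(i, j)}" for p
        using zero[of p] that uniq[OF ij(1)] ij(2) by (cases p) auto
      then have "(\<Sum>p\<in>E - {(i, j)}. (q (fst p) (snd p) x)\<^sup>2 * T (fst p) x * T (snd p) x) = 0"
        by (intro sum.neutral) (simp add: mult.assoc)
      then have "(\<Sum>(i, j)\<in>E. (q i j x)\<^sup>2 * T i x * T j x) = (q i j x)\<^sup>2 * T i x * T j x"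
        using sum.remove[OF finE ij(1), of "\<lambda>p. (q (fst p) (snd p) x)\<^sup>2 * T (fst p) x * T (snd p) x"]
        by (simp add: case_prod_beta)
      then show ?thesis
        using PQ(4)[OF 1 ij \<sigma>(2)] q(3)[OF ij(1) 1 ij(2) \<sigma>(2)] hx h(3)[OF 1] by simp
    next
      case (2 w)
      \<comment> \<open>This excludes the exceptional branch of \<open>val\<close>: on a point facet
        every tent product vanishes, so \<open>h\<close> alone must produce F there.\<close>
      have "w \<notin> simplex_vertices \<sigma>0"
      proof
        assume "w \<in> simplex_vertices \<sigma>0"
        then have "\<sigma> \<subseteq> \<sigma>0" using 2 simplex_vertices_subset[OF K(1) edgeK[OF \<sigma>0]] by blast
        moreover have "\<sigma> \<noteq> \<sigma>0" using 2 \<sigma>0 by blast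
        ultimately show False using K(1) \<sigma>(1) edgeK[OF \<sigma>0] unfolding facet_complex_def by blast
      qed
      then have "h x = sqrt (F x)" using hx h(4)[OF \<sigma>(1)] 2 \<sigma>(2) by (simp add: val_def)
      moreover have "0 \<le> F x" using nonneg x by blast
      ultimately have Fh: "F x = (h x)\<^sup>2" by simp
      have "T (fst p) x * T (snd p) x = 0" if p: "p \<in> E" for p
      proof (rule zero[OF _ p])
        have "fst p \<in> {1..m}" "snd p \<in> {1..m}" "fst p \<noteq> snd p" using p unfolding E by auto
        then show "simplex_vertices \<sigma> \<noteq> {v (fst p), v (snd p)}"
          using 2 inj_onD[OF inj, of "fst p" "snd p"] by auto
      qed (use 2 in auto)
      then have "(\<Sum>p\<in>E. (q (fst p) (snd p) x)\<^sup>2 * T (fst p) x * T (snd p) x) = 0"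
        by (intro sum.neutral) (simp add: mult.assoc)
      then show ?thesis using Fh by (simp add: case_prod_beta)
    qed
  qed
  moreover have "pw_degree K (\<lambda>x. (h x)\<^sup>2) \<le> D"
    using pw_degree_square_le[OF fin Kne h(2)] h(5) by blast
  ultimately show ?thesis using that[of h q] h(1) q(1,2) by blast
qed

theorem theorem2p6:
  fixes K :: "(real ^ 'n::finite) set set"
    and v :: "nat \<Rightarrow> real ^ 'n"
    and T :: "nat \<Rightarrow> real ^ 'n \<Rightarrow> real"
    and F :: "real ^ 'n \<Rightarrow> real"
    and e m m0 :: nat
    and E :: "(nat \<times> nat) set"
  assumes "facet_complex K"
    and "has_dimension K 1"
    and "e = card (complex_edges K)"
    and "bij_betw v {1..m} (complex_vertices K)"
    and "m0 = card (isolated_vertices K)"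
    and "E = {(i, j). 1 \<le> i \<and> i < j \<and> j \<le> m \<and>
                (\<exists>\<sigma>\<in>complex_edges K. simplex_vertices \<sigma> = {v i, v j})}"
    and "\<forall>i\<in>{1..m}. tent_function K (v i) (T i)"
    and "F \<in> C0 K"
  shows "((\<forall>x\<in>\<Union>K. F x \<ge> 0) \<longleftrightarrow>
           (\<exists>S S'. (\<exists>N. sum_of_squares K N S) \<and>
                   (\<forall>(i, j)\<in>E. \<exists>N. sum_of_squares K N (S' i j)) \<and>
                   (\<forall>x\<in>\<Union>K. F x = S x + (\<Sum>(i, j)\<in>E. S' i j x * T i x * T j x)))) \<and>
         ((\<forall>x\<in>\<Union>K. F x \<ge> 0) \<longrightarrow>
           (\<exists>S S'. (\<exists>N\<le>2 * e + m0. sum_of_squares K N S) \<and>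
                   pw_degree K S \<le> pw_degree K F + 6 * (e - 1) + 1 \<and>
                   (\<forall>(i, j)\<in>E. sum_of_squares K 2 (S' i j) \<and>
                               pw_degree K (S' i j) \<le> pw_degree K F + 6 * (e - 1) + 1) \<and>
                   (\<forall>x\<in>\<Union>K. F x = S x + (\<Sum>(i, j)\<in>E. S' i j x * T i x * T j x))))"
    (is "(?nonneg \<longleftrightarrow> ?sos) \<and> (?nonneg \<longrightarrow> ?bounded)")
proof -
  have bounded: ?bounded if nonneg: ?nonneg
  proof -
    have T: "tent_function K (v i) (T i)" if "i \<in> {1..m}" for i using assms(7) that by blast
    obtain h q where hq: "h \<in> C0 K" "pw_degree K (\<lambda>x. (h x)\<^sup>2) \<le> pw_degree K F + 6 * (e - 1) + 1"
      "\<And>i j. (i, j) \<in> E \<Longrightarrow> q i j \<in> C0 K \<and>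
        pw_degree K (\<lambda>x. (q i j x)\<^sup>2) \<le> pw_degree K F + 6 * (e - 1) + 1"
      "\<And>x. x \<in> \<Union>K \<Longrightarrow> F x = (h x)\<^sup>2 + (\<Sum>(i, j)\<in>E. (q i j x)\<^sup>2 * T i x * T j x)"
      using nonneg_certificate[OF assms(1-4,6) T assms(8) nonneg refl] by blast
    have "finite (complex_edges K)"
      using assms(1) by (simp add: facet_complex_def complex_edges_def)
    \<comment> \<open>Dimension 1 provides an edge, so the allowed number of squares leaves room for
      the single one.\<close>
    then have "1 \<le> 2 * e + m0"
      using complex_edges_nonempty[OF assms(1,2)] assms(3) card_gt_0_iff[of "complex_edges K"] by linarith
    then have "\<exists>N\<le>2 * e + m0. sum_of_squares K N (\<lambda>x. (h x)\<^sup>2)"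
      using sum_of_squares_square[OF hq(1) order_refl] by blast
    moreover have "\<forall>(i, j)\<in>E. sum_of_squares K 2 (\<lambda>x. (q i j x)\<^sup>2) \<and>
        pw_degree K (\<lambda>x. (q i j x)\<^sup>2) \<le> pw_degree K F + 6 * (e - 1) + 1"
      using sum_of_squares_square[of _ K 2] hq(3) by auto
    ultimately show ?thesis
      using hq(2,4)
      by (intro exI[of _ "\<lambda>x. (h x)\<^sup>2"] exI[of _ "\<lambda>i j x. (q i j x)\<^sup>2"]) blast
  qed
  \<comment> \<open>The converse rests on the tent functions being non-negative, which makes every
    weighted term non-negative.\<close>
  moreover have ?nonneg if sos: ?sos
  proof
    fix x assume x: "x \<in> \<Union>K"
    obtain S S' where S: "\<exists>N. sum_of_squares K N S" "\<forall>(i, j)\<in>E. \<exists>N. sum_of_squares K N (S' i j)"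
      "F x = S x + (\<Sum>(i, j)\<in>E. S' i j x * T i x * T j x)"
      using sos x by blast
    have "0 \<le> S' i j x * T i x * T j x" if ij: "(i, j) \<in> E" for i j
    proof -
      have "i \<in> {1..m}" "j \<in> {1..m}" using ij assms(6) by auto
      then have "0 \<le> T i x" "0 \<le> T j x"
        using assms(7) tent_function_nonneg[OF assms(1) _ x] by blast+
      moreover have "0 \<le> S' i j x" using S(2) ij sum_of_squares_nonneg x by blast
      ultimately show ?thesis by simp
    qed
    then have "0 \<le> (\<Sum>(i, j)\<in>E. S' i j x * T i x * T j x)" by (intro sum_nonneg) auto
    moreover have "0 \<le> S x" using S(1) sum_of_squares_nonneg x by blast
    ultimately show "0 \<le> F x" using S(3) by simp
  qed
  moreover have ?sos if ?nonneg
    using bounded[OF that] by (elim exE conjE) (intro exI conjI; fast)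
  ultimately show ?thesis by blast
qed

end
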